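(* Let $(x,v,\xi)$ be a global solution of the system (AMPD-DI) described in the context, with initial data $(x_0,v_0,\xi_0)$, and let $\bar x\in\Omega$ be arbitrary. Then, with the objective gap function $U$ and the constant $\alpha_3(\bar x)$ defined in the context, $$|U(x(t))|\le \alpha_3(\bar x)\,e^{-t}\qquad\text{for all } t>0.$$
   Context: Setting. Let $m,n,r\ge 1$, $A\in\mathbb R^{r\times n}$ with $A\neq 0$, $b\in\mathbb R^r$, and assume $\Omega:=\{x\in\mathbb R^n: Ax=b\}\neq\emptyset$. For $1\le j\le m$ let $f_j:\mathbb R^n\to\mathbb R$ be a $C^1$ function whose gradient is $L_j$-Lipschitz and which satisfies $f_j(y)-f_j(x)-\langle\nabla f_j(x),y-x\rangle\ge\frac{\mu_j}{2}\|x-y\|^2$ for all $x,y$, where $0\le\mu_j\le L_j<\infty$. Put $\mu:=\min_j\mu_j$, $L:=\max_j L_j$ and $F:=(f_1,\dots,f_m)^\top$. Norms are Euclidean (operator norm for matrices), and $\sigma_{\min}^+(A)$ is the smallest nonzero singular value of $A$. Inequalities between vectors of $\mathbb R^m$, and maxima of such vectors, are componentwise ($p<q$ means $p_j<q_j$ for all $j$). A point $x^*\in\Omega$ is weakly Pareto optimal if there is no $x\in\Omega$ with $F(x)<F(x^* )$; $P_w$ is the set of weakly Pareto optimal points. The objective gap function is $U(x):=\sup_{z\in\Omega}\min_{1\le j\le m}[f_j(x)-f_j(z)]$. Level-set assumption. For every $j$ and every $\alpha\in\mathbb R$, $\mathcal L_{f_j}(\alpha)=\{x: f_j(x)\le\alpha\}$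 is bounded. Put $R_j(\alpha):=\sup\{\|x\|:x\in\mathcal L_{f_j}(\alpha)\}$ and $R(\alpha):=\max_jR_j(\alpha)<\infty$. Pareto assumption. Let $\mathcal L_F(\boldsymbol\alpha):=\{x\in\mathbb R^n:F(x)\le\boldsymbol\alpha\}$ for $\boldsymbol\alpha\in\mathbb R^m$. There is $\boldsymbol\alpha_*\in\mathbb R^m$ (fixed from now on) with $\mathcal L_F(\boldsymbol\alpha_* )\cap\Omega\ne\emptyset$; moreover, for every $\boldsymbol\alpha\in\mathbb R^m$ with $\mathcal L_F(\boldsymbol\alpha)\cap\Omega\ne\emptyset$ and every $x\in\mathcal L_F(\boldsymbol\alpha)\cap\Omega$ there exists at least one $x^*\in P_w\cap\mathcal L_F(F(x))$. For such $\boldsymbol\alpha$ put $$D(\boldsymbol\alpha):=\sup_{F^*\in F(P_w\cap\mathcal L_F(\boldsymbol\alpha))}\ \inf_{z\in F^{-1}(F^* )\cap\Omega}\|z\|,$$ which is finite. Dynamical system. Let $\theta_0,\gamma_0>0$ and let $\theta,\gamma:[0,\infty)\to\mathbb R$ solve $\theta'=-\theta$, $\theta(0)=\theta_0$ and $\gamma'=\mu-\gamma$, $\gamma(0)=\gamma_0$. Let $C(x):=\mathrm{conv}\{\nabla f_1(x),\dots,\nabla f_m(x)\}$. A global solution of (AMPD-DI) with initial data $x(0)=x_0\in\mathbb R^n$, $v(0)=v_0\in\mathbb R^n$, $\xi(0)=\xi_0\in\mathbb R^r$ is a triple $(x,v,\xi)\in C^1([0,\infty);\mathbb R^n)\times AC([0,\infty);\mathbb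 R^n)\times C^1([0,\infty);\mathbb R^r)$ ($AC$ = absolutely continuous) having these initial values and satisfying $$\theta\xi'=Av-b,\qquad x'=v-x,\qquad \gamma v'\in\mu(x-v)-A^\top\xi-\operatorname*{argmin}_{z\in C(x)}\langle x-v,z\rangle,$$ where the inclusion holds for almost every $t\ge 0$. Constants. For $s,t\ge0$, $$C_0(s,t):=\big(\max_j\|\nabla f_j(0)\|+Ls\big)(\|x_0\|+s)+L(\|x_0\|^2+s^2)+t\|Ax_0-b\|+\gamma_0(\|v_0\|^2+s^2)+\theta_0(\|\xi_0\|^2+t^2),$$ $$C_1(s):=\big(\max_j\|\nabla f_j(0)\|+L\|x_0\|\big)(\|x_0\|+s)+L(\|x_0\|^2+s^2).$$ For $\bar x\in\Omega$, $$\alpha_0(\bar x):=C_0(\|\bar x\|,0)+C_1(\|\bar x\|)+\max_j|f_j(x_0)|,$$ $$\alpha_1(\bar x):=\Big(1+\frac{\|A\|}{\sigma_{\min}^+(A)}\Big)R(\alpha_0(\bar x))+\frac{\|b\|}{\sigma_{\min}^+(A)},\qquad \alpha_2(\bar x):=\frac{L\,\alpha_1(\bar x)+\max_j\|\nabla f_j(0)\|}{\sigma_{\min}^+(A)},$$ $$\boldsymbol\alpha(\bar x):=\max\{\boldsymbol\alpha_*,\,F(x_0)+C_1(R(\alpha_0(\bar x)))\}\in\mathbb R^m$$ (the scalar $C_1(\cdot)$ is added to every component), and $$\alpha_3(\bar x):=\max\big\{C_0(D(\boldsymbol\alpha(\bar x)),0),\ \alpha_2(\bar x)\,C_0(\alpha_1(\bar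 x),1+\alpha_2(\bar x))\big\}.$$ *)

theory Defs
  imports "HOL-Analysis.Analysis"
begin

text \<open>
  The dimensions \<open>n\<close>, \<open>m\<close>, \<open>r\<close> are the finite index types \<open>'n\<close>, \<open>'m\<close>, \<open>'r\<close>. Suprema and
  infima are taken in \<^typ>\<open>real\<close>; under the standing assumptions every set to which they are
  applied below is nonempty and bounded on the relevant side.
\<close>

definition grad :: "('a::real_inner \<Rightarrow> real) \<Rightarrow> 'a \<Rightarrow> 'a" where
  "grad f x = (THE D. GDERIV f x :> D)"

definition feasible :: "real^'n^'r \<Rightarrow> real^'r \<Rightarrow> (real^'n) set" where
  "feasible A b = {x. A *v x = b}"

definition objective :: "('m::finite \<Rightarrow> 'a \<Rightarrow> real) \<Rightarrow> 'a \<Rightarrow> real^'m" where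
  "objective f x = (\<chi> j. f j x)"

text \<open>The library's strict order on vectors is not the componentwise one, so \<open>F x < F x\<^sub>*\<close> is
  written out.\<close>

definition weak_pareto :: "('m::finite \<Rightarrow> 'a \<Rightarrow> real) \<Rightarrow> 'a set \<Rightarrow> 'a set" where
  "weak_pareto f \<Omega> =
     {xs \<in> \<Omega>. \<not> (\<exists>x\<in>\<Omega>. \<forall>j. objective f x $ j < objective f xs $ j)}"

definition gap :: "('m::finite \<Rightarrow> 'a \<Rightarrow> real) \<Rightarrow> 'a set \<Rightarrow> 'a \<Rightarrow> real" where
  "gap f \<Omega> x = (SUP z\<in>\<Omega>. MIN j. f j x - f j z)"

definition level_set :: "('a \<Rightarrow> real) \<Rightarrow> real \<Rightarrow> 'a set" where
  "level_set h a = {x. h x \<le> a}"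

text \<open>Here \<open>\<le>\<close> on \<^typ>\<open>real^'m\<close> is the componentwise order.\<close>

definition vlevel_set :: "('m::finite \<Rightarrow> 'a \<Rightarrow> real) \<Rightarrow> real^'m \<Rightarrow> 'a set" where
  "vlevel_set f a = {x. objective f x \<le> a}"

definition level_radius :: "('m::finite \<Rightarrow> real^'n \<Rightarrow> real) \<Rightarrow> real \<Rightarrow> real" where
  "level_radius f a = (MAX j. SUP x\<in>level_set (f j) a. norm x)"

definition pareto_radius ::
  "('m::finite \<Rightarrow> real^'n \<Rightarrow> real) \<Rightarrow> (real^'n) set \<Rightarrow> real^'m \<Rightarrow> real" where
  "pareto_radius f \<Omega> a =
     (SUP Fs\<in>objective f ` (weak_pareto f \<Omega> \<inter> vlevel_set f a).
        INF z\<in>objective f -` {Fs} \<inter> \<Omega>. norm z)"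

definition c1_on :: "real set \<Rightarrow> (real \<Rightarrow> 'a::real_normed_vector) \<Rightarrow> bool" where
  "c1_on S u \<longleftrightarrow>
     (\<exists>u'. (\<forall>t\<in>S. (u has_vector_derivative u' t) (at t within S)) \<and> continuous_on S u')"

definition abs_continuous_on :: "real set \<Rightarrow> (real \<Rightarrow> 'a::real_normed_vector) \<Rightarrow> bool" where
  "abs_continuous_on S u \<longleftrightarrow>
     (\<forall>\<epsilon>>0. \<exists>\<delta>>0. \<forall>I.
        finite I \<and> (\<forall>(p, q)\<in>I. p \<le> q \<and> {p..q} \<subseteq> S) \<and>
        disjoint_family_on (\<lambda>(p, q). {p<..<q}) I \<and> (\<Sum>(p, q)\<in>I. q - p) < \<delta>
        \<longrightarrow> (\<Sum>(p, q)\<in>I. norm (u q - u p)) < \<epsilon>)"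

definition argmin_on :: "'a set \<Rightarrow> ('a \<Rightarrow> real) \<Rightarrow> 'a set" where
  "argmin_on S h = {z. is_arg_min h (\<lambda>z. z \<in> S) z}"

definition grad_hull :: "('m \<Rightarrow> real^'n \<Rightarrow> real) \<Rightarrow> real^'n \<Rightarrow> (real^'n) set" where
  "grad_hull f x = convex hull (range (\<lambda>j. grad (f j) x))"

text \<open>Absolute continuity on the half-line is understood as absolute continuity on every compact
  subinterval, as usual for solutions of differential inclusions; this is the weaker reading, so
  every function satisfying the global epsilon-delta condition is covered. The derivative of \<open>v\<close>
  then exists almost everywhere.\<close>

definition ampd_di_solution ::
  "('m \<Rightarrow> real^'n \<Rightarrow> real) \<Rightarrow> real \<Rightarrow> real^'n^'r \<Rightarrow> real^'r \<Rightarrow> (real \<Rightarrow> real) \<Rightarrow> (real \<Rightarrow> real) \<Rightarrow>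
   real^'n \<Rightarrow> real^'n \<Rightarrow> real^'r \<Rightarrow>
   (real \<Rightarrow> real^'n) \<Rightarrow> (real \<Rightarrow> real^'n) \<Rightarrow> (real \<Rightarrow> real^'r) \<Rightarrow> bool" where
  "ampd_di_solution f \<mu> A b \<theta> \<gamma> x0 v0 \<xi>0 x v \<xi> \<longleftrightarrow>
     c1_on {0..} x \<and> (\<forall>T\<ge>0. abs_continuous_on {0..T} v) \<and> c1_on {0..} \<xi> \<and>
     x 0 = x0 \<and> v 0 = v0 \<and> \<xi> 0 = \<xi>0 \<and>
     (\<forall>t\<ge>0. \<exists>d. (\<xi> has_vector_derivative d) (at t within {0..}) \<and>
        \<theta> t *\<^sub>R d = A *v v t - b) \<and>
     (\<forall>t\<ge>0. (x has_vector_derivative (v t - x t)) (at t within {0..})) \<and>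
     (AE t in lebesgue_on {0..}. \<exists>d. (v has_vector_derivative d) (at t within {0..}) \<and>
        \<gamma> t *\<^sub>R d \<in> (\<lambda>z. \<mu> *\<^sub>R (x t - v t) - transpose A *v \<xi> t - z) `
          argmin_on (grad_hull f (x t)) (\<lambda>z. (x t - v t) \<bullet> z))"

abbreviation opnorm :: "real^'n^'r \<Rightarrow> real" where
  "opnorm A \<equiv> onorm ((*v) A)"

text \<open>Singular values are the square roots of the eigenvalues of \<open>A\<^sup>T A\<close>.\<close>

definition singular_values :: "real^'n^'r \<Rightarrow> real set" where
  "singular_values A =
     {sqrt l |l. \<exists>u. u \<noteq> 0 \<and> (transpose A ** A) *v u = l *\<^sub>R u}"

definition sigma_min_pos :: "real^'n^'r \<Rightarrow> real" where
  "sigma_min_pos A = Min (singular_values A - {0})"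

definition C0 ::
  "('m::finite \<Rightarrow> real^'n \<Rightarrow> real) \<Rightarrow> real \<Rightarrow> real^'n^'r \<Rightarrow> real^'r \<Rightarrow> real \<Rightarrow> real \<Rightarrow>
   real^'n \<Rightarrow> real^'n \<Rightarrow> real^'r \<Rightarrow> real \<Rightarrow> real \<Rightarrow> real" where
  "C0 f L A b \<theta>0 \<gamma>0 x0 v0 \<xi>0 s t =
     ((MAX j. norm (grad (f j) 0)) + L * s) * (norm x0 + s) + L * ((norm x0)\<^sup>2 + s\<^sup>2)
     + t * norm (A *v x0 - b) + \<gamma>0 * ((norm v0)\<^sup>2 + s\<^sup>2) + \<theta>0 * ((norm \<xi>0)\<^sup>2 + t\<^sup>2)"

definition C1 :: "('m::finite \<Rightarrow> real^'n \<Rightarrow> real) \<Rightarrow> real \<Rightarrow> real^'n \<Rightarrow> real \<Rightarrow> real" where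
  "C1 f L x0 s =
     ((MAX j. norm (grad (f j) 0)) + L * norm x0) * (norm x0 + s) + L * ((norm x0)\<^sup>2 + s\<^sup>2)"

definition alpha0 ::
  "('m::finite \<Rightarrow> real^'n \<Rightarrow> real) \<Rightarrow> real \<Rightarrow> real^'n^'r \<Rightarrow> real^'r \<Rightarrow> real \<Rightarrow> real \<Rightarrow>
   real^'n \<Rightarrow> real^'n \<Rightarrow> real^'r \<Rightarrow> real^'n \<Rightarrow> real" where
  "alpha0 f L A b \<theta>0 \<gamma>0 x0 v0 \<xi>0 xbar =
     C0 f L A b \<theta>0 \<gamma>0 x0 v0 \<xi>0 (norm xbar) 0 + C1 f L x0 (norm xbar) + (MAX j. \<bar>f j x0\<bar>)"

definition alpha1 ::
  "('m::finite \<Rightarrow> real^'n \<Rightarrow> real) \<Rightarrow> real \<Rightarrow> real^'n^'r \<Rightarrow> real^'r \<Rightarrow> real \<Rightarrow> real \<Rightarrow>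
   real^'n \<Rightarrow> real^'n \<Rightarrow> real^'r \<Rightarrow> real^'n \<Rightarrow> real" where
  "alpha1 f L A b \<theta>0 \<gamma>0 x0 v0 \<xi>0 xbar =
     (1 + opnorm A / sigma_min_pos A) * level_radius f (alpha0 f L A b \<theta>0 \<gamma>0 x0 v0 \<xi>0 xbar)
     + norm b / sigma_min_pos A"

definition alpha2 ::
  "('m::finite \<Rightarrow> real^'n \<Rightarrow> real) \<Rightarrow> real \<Rightarrow> real^'n^'r \<Rightarrow> real^'r \<Rightarrow> real \<Rightarrow> real \<Rightarrow>
   real^'n \<Rightarrow> real^'n \<Rightarrow> real^'r \<Rightarrow> real^'n \<Rightarrow> real" where
  "alpha2 f L A b \<theta>0 \<gamma>0 x0 v0 \<xi>0 xbar =
     (L * alpha1 f L A b \<theta>0 \<gamma>0 x0 v0 \<xi>0 xbar + (MAX j. norm (grad (f j) 0))) / sigma_min_pos A"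

definition alpha_vec ::
  "('m::finite \<Rightarrow> real^'n \<Rightarrow> real) \<Rightarrow> real \<Rightarrow> real^'n^'r \<Rightarrow> real^'r \<Rightarrow> real \<Rightarrow> real \<Rightarrow>
   real^'n \<Rightarrow> real^'n \<Rightarrow> real^'r \<Rightarrow> real^'m \<Rightarrow> real^'n \<Rightarrow> real^'m" where
  "alpha_vec f L A b \<theta>0 \<gamma>0 x0 v0 \<xi>0 \<alpha>s xbar =
     (\<chi> j. max (\<alpha>s $ j)
       (objective f x0 $ j +
        C1 f L x0 (level_radius f (alpha0 f L A b \<theta>0 \<gamma>0 x0 v0 \<xi>0 xbar))))"

definition alpha3 ::
  "('m::finite \<Rightarrow> real^'n \<Rightarrow> real) \<Rightarrow> real \<Rightarrow> real^'n^'r \<Rightarrow> real^'r \<Rightarrow> real \<Rightarrow> real \<Rightarrow>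
   real^'n \<Rightarrow> real^'n \<Rightarrow> real^'r \<Rightarrow> real^'m \<Rightarrow> real^'n \<Rightarrow> real" where
  "alpha3 f L A b \<theta>0 \<gamma>0 x0 v0 \<xi>0 \<alpha>s xbar =
     (let D = pareto_radius f (feasible A b)
                (alpha_vec f L A b \<theta>0 \<gamma>0 x0 v0 \<xi>0 \<alpha>s xbar);
          a1 = alpha1 f L A b \<theta>0 \<gamma>0 x0 v0 \<xi>0 xbar;
          a2 = alpha2 f L A b \<theta>0 \<gamma>0 x0 v0 \<xi>0 xbar
      in max (C0 f L A b \<theta>0 \<gamma>0 x0 v0 \<xi>0 D 0)
             (a2 * C0 f L A b \<theta>0 \<gamma>0 x0 v0 \<xi>0 a1 (1 + a2)))"

end

theory Submission
  imports Defs
begin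

text \<open>
  For feasible \<open>z\<close> and a multiplier \<open>\<eta>\<close>, the Lyapunov function
  \<open>E = min\<^sub>j (f\<^sub>j x - f\<^sub>j z) + \<eta> \<bullet> (A x - b) + \<gamma>/2 |v - z|\<^sup>2 + \<theta>/2 |\<xi> - \<eta>|\<^sup>2\<close>
  satisfies \<open>E' \<le> - E\<close> almost everywhere: the argmin condition makes the selected hull element \<open>g\<close>
  dominate every \<open>\<nabla>f\<^sub>j x \<bullet> x'\<close>, and convexity bounds \<open>g \<bullet> (z - x)\<close>. Since \<open>v\<close> is absolutely
  continuous, \<open>exp t * E t\<close> is nonincreasing, so \<open>E t \<le> exp (- t) * E 0\<close>.

  With \<open>\<eta> = 0\<close> this bounds \<open>min\<^sub>j (f\<^sub>j x - f\<^sub>j z)\<close> from above in terms of \<open>|z|\<close>; first \<open>z = xbar\<close>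
  bounds the trajectory, and then any relevant \<open>z\<close> may be replaced by a weakly Pareto point below
  it of norm at most the Pareto radius. For the lower bound, take for \<open>z\<close> the projection of \<open>x t\<close>
  onto the feasible set, so that \<open>|x t - z| \<le> |A x t - b| / \<sigma>\<close>, and let \<open>\<eta>\<close> be the multiple of
  norm \<open>1 + \<alpha>\<^sub>2\<close> of the unit residual: the residual then decays like \<open>exp (- t)\<close>, and the gradient
  bound at \<open>z\<close> transfers this to the gap.
\<close>

section \<open>Monotonicity from an almost everywhere estimate under absolute continuity\<close>

lemma abs_continuous_onD:
  assumes "abs_continuous_on S u" "\<epsilon> > 0"
  shows "\<exists>\<delta>>0. \<forall>I. finite I \<longrightarrow> (\<forall>p q. (p, q) \<in> I \<longrightarrow> p \<le> q \<and> {p..q} \<subseteq> S) \<longrightarrow>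
       disjoint_family_on (\<lambda>(p, q). {p<..<q}) I \<longrightarrow> (\<Sum>(p, q)\<in>I. q - p) < \<delta> \<longrightarrow>
       (\<Sum>(p, q)\<in>I. norm (u q - u p)) < \<epsilon>"
proof -
  from assms(1)[unfolded abs_continuous_on_def, rule_format, OF assms(2)]
  obtain \<delta> where "\<delta> > 0" and \<delta>: "\<And>I. finite I \<and> (\<forall>(p, q)\<in>I. p \<le> q \<and> {p..q} \<subseteq> S) \<and>
        disjoint_family_on (\<lambda>(p, q). {p<..<q}) I \<and> (\<Sum>(p, q)\<in>I. q - p) < \<delta>
        \<longrightarrow> (\<Sum>(p, q)\<in>I. norm (u q - u p)) < \<epsilon>"
    by blast
  show ?thesis
    by (intro exI[of _ \<delta>] conjI \<open>\<delta> > 0\<close> allI impI, rule \<delta>[rule_format]) auto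
qed

text \<open>Absolute continuity speaks of endpoint pairs, a division of tagged sets. Degenerate
  intervals are dropped first: they contribute nothing to the sums, and without them different
  members have different endpoint pairs, so the sums transfer along \<open>g\<close>.\<close>

lemma tagged_division_AC_sum_small:
  fixes v :: "real \<Rightarrow> 'a::real_normed_vector"
  assumes \<delta>: "\<And>I. finite I \<Longrightarrow> (\<And>p q. (p, q) \<in> I \<Longrightarrow> p \<le> q \<and> {p..q} \<subseteq> {a..b}) \<Longrightarrow>
       disjoint_family_on (\<lambda>(p, q). {p<..<q}) I \<Longrightarrow> (\<Sum>(p, q)\<in>I. q - p) < \<delta> \<Longrightarrow>
       (\<Sum>(p, q)\<in>I. norm (v q - v p)) < \<epsilon>"
    and D: "D tagged_division_of {a..b}"
    and small: "(\<Sum>(t, k)\<in>{(t, k)\<in>D. t \<in> N}. Sup k - Inf k) < \<delta>"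
  shows "(\<Sum>(t, k)\<in>{(t, k)\<in>D. t \<in> N}. norm (v (Sup k) - v (Inf k))) < \<epsilon>"
proof -
  have fin: "finite D" using D by blast
  define P where "P = {(t, k)\<in>D. t \<in> N}"
  define Q where "Q = {(t, k)\<in>P. Inf k < Sup k}"
  define g where "g = (\<lambda>(t::real, k::real set). (Inf k, Sup k))"
  have finP: "finite P" and QP: "Q \<subseteq> P"
    unfolding P_def Q_def using fin by (auto intro: finite_subset[OF _ fin])
  have k: "k = {Inf k..Sup k} \<and> Inf k \<le> Sup k \<and> k \<subseteq> {a..b}" if tk: "(t, k) \<in> D" for t k
  proof -
    obtain c d where "k = {c..d}" using tagged_division_ofD(4)[OF D tk] by auto
    moreover have "t \<in> k" using tagged_division_ofD(2)[OF D tk] .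
    ultimately show ?thesis using tagged_division_ofD(3)[OF D tk] by auto
  qed
  have disj: "{Inf k1<..<Sup k1} \<inter> {Inf k2<..<Sup k2} = {}"
    if "(t1, k1) \<in> D" "(t2, k2) \<in> D" "(t1, k1) \<noteq> (t2, k2)" for t1 k1 t2 k2
  proof -
    have "interior k1 \<inter> interior k2 = {}" using tagged_division_ofD(5)[OF D that] .
    moreover have "interior k1 = {Inf k1<..<Sup k1}" using k[OF that(1)]
      by (metis interior_cbox box_real)
    moreover have "interior k2 = {Inf k2<..<Sup k2}" using k[OF that(2)]
      by (metis interior_cbox box_real)
    ultimately show ?thesis by simp
  qed
  \<comment> \<open>Equal endpoints would give two different members the same nonempty interior,
    against the disjointness of interiors.\<close>
  have inj: "inj_on g Q"
  proof (rule inj_onI, clarify)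
    fix t1 k1 t2 k2 assume *: "(t1, k1) \<in> Q" "(t2, k2) \<in> Q" "g (t1, k1) = g (t2, k2)"
    then have D': "(t1, k1) \<in> D" "(t2, k2) \<in> D" "Inf k1 < Sup k1" "Inf k1 = Inf k2" "Sup k1 = Sup k2"
      by (auto simp: Q_def P_def g_def)
    then show "t1 = t2 \<and> k1 = k2" using disj[OF D'(1,2)] by (metis Int_absorb greaterThanLessThan_empty_iff not_le prod.inject)
  qed
  have sumg: "(\<Sum>(p, q)\<in>g ` Q. h p q) = (\<Sum>(t, k)\<in>P. h (Inf k) (Sup k))"
    if h: "\<And>p. h p p = 0" for h :: "real \<Rightarrow> real \<Rightarrow> real"
  proof -
    have "(\<Sum>(p, q)\<in>g ` Q. h p q) = (\<Sum>(t, k)\<in>Q. h (Inf k) (Sup k))"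
      by (subst sum.reindex[OF inj]) (auto simp: g_def case_prod_unfold)
    also have "\<dots> = (\<Sum>(t, k)\<in>P. h (Inf k) (Sup k))"
    proof (rule sum.mono_neutral_left[OF finP QP], clarify)
      fix t k assume "(t, k) \<in> P" "(t, k) \<notin> Q"
      then have "(t, k) \<in> D" "\<not> Inf k < Sup k" by (auto simp: P_def Q_def)
      then show "h (Inf k) (Sup k) = 0" using k[of t k] h by force
    qed
    finally show ?thesis .
  qed
  have "(\<Sum>(p, q)\<in>g ` Q. norm (v q - v p)) < \<epsilon>"
  proof (rule \<delta>)
    show "finite (g ` Q)" using finP QP finite_subset by blast
    show "p \<le> q \<and> {p..q} \<subseteq> {a..b}" if "(p, q) \<in> g ` Q" for p q
    proof -
      from that obtain t k where "(t, k) \<in> D" "p = Inf k" "q = Sup k"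
        by (auto simp: g_def Q_def P_def)
      then show ?thesis using k by metis
    qed
    show "disjoint_family_on (\<lambda>(p, q). {p<..<q}) (g ` Q)"
      unfolding disjoint_family_on_def
    proof (intro ballI impI)
      fix m n assume "m \<in> g ` Q" "n \<in> g ` Q" "m \<noteq> n"
      then obtain t1 k1 t2 k2 where "m = (Inf k1, Sup k1)" "n = (Inf k2, Sup k2)"
        "(t1, k1) \<in> D" "(t2, k2) \<in> D" "(t1, k1) \<noteq> (t2, k2)"
        by (auto simp: g_def Q_def P_def)
      then show "(case m of (p, q) \<Rightarrow> {p<..<q}) \<inter> (case n of (p, q) \<Rightarrow> {p<..<q}) = {}"
        using disj by auto
    qed
    show "(\<Sum>(p, q)\<in>g ` Q. q - p) < \<delta>"
      using small sumg[of "\<lambda>p q. q - p"] by (simp add: P_def)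
  qed
  then show ?thesis using sumg[of "\<lambda>p q. norm (v q - v p)"] by (simp add: P_def)
qed

text \<open>A covering argument in the style of the Henstock integral: \<open>u b - u a\<close>
  telescopes over a fine tagged division. Intervals tagged outside \<open>N\<close> obey the
  straddle bound; those tagged in \<open>N\<close> are short in total, and \<open>dom\<close> with
  absolute continuity of \<open>v\<close> bounds their share. Straddle bounds stand in for
  derivatives because the minimum treated later may have kinks.\<close>

lemma AC_dominated_straddle_le:
  fixes u :: "real \<Rightarrow> real" and v :: "real \<Rightarrow> 'a::real_normed_vector"
  assumes ab: "a \<le> b" and ac: "abs_continuous_on {a..b} v" and N: "negligible N"
    and dom: "\<And>p q. \<lbrakk>a \<le> p; p \<le> q; q \<le> b\<rbrakk> \<Longrightarrow> u q - u p \<le> K * ((q - p) + norm (v q - v p))"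
    and K: "K \<ge> 0"
    and straddle: "\<And>t e. \<lbrakk>t \<in> {a..b} - N; e > 0\<rbrakk> \<Longrightarrow>
       \<exists>d>0. \<forall>p q. a \<le> p \<and> p \<le> t \<and> t \<le> q \<and> q \<le> b \<and> q - p < d \<longrightarrow> u q - u p \<le> e * (q - p)"
  shows "u b \<le> u a"
proof (rule field_le_epsilon)
  fix e :: real assume "e > 0"
  \<comment> \<open>The denominator collects the share \<open>b - a\<close> of the intervals tagged
    outside \<open>N\<close> and \<open>2 * K\<close> of the others; the summand 1 keeps it positive
    when both vanish.\<close>
  define e' where "e' = e / (b - a + 2 * K + 1)"
  have den: "b - a + 2 * K + 1 > 0" using ab K by simp
  then have e': "e' > 0" using \<open>e > 0\<close> by (simp add: e'_def)
  from abs_continuous_onD[OF ac e'] obtain \<delta> where \<delta>: "\<delta> > 0"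
    "\<forall>I. finite I \<longrightarrow> (\<forall>p q. (p, q) \<in> I \<longrightarrow> p \<le> q \<and> {p..q} \<subseteq> {a..b}) \<longrightarrow>
       disjoint_family_on (\<lambda>(p, q). {p<..<q}) I \<longrightarrow> (\<Sum>(p, q)\<in>I. q - p) < \<delta> \<longrightarrow>
       (\<Sum>(p, q)\<in>I. norm (v q - v p)) < e'" by blast
  text \<open>The gauge \<open>g1\<close> witnessing that \<open>N\<close> is negligible makes the intervals tagged in \<open>N\<close> short
    in total, so absolute continuity controls them; \<open>g2\<close> makes the others obey the straddle bound.\<close>
  have "((indicator N :: real \<Rightarrow> real) has_integral 0) {a..b}"
    using N unfolding negligible_def by (metis box_real(2))
  moreover have "min \<delta> e' > 0" using \<delta> e' by simp
  ultimately obtain g1 where g1: "gauge g1" "\<And>D. D tagged_division_of {a..b} \<Longrightarrow> g1 fine D \<Longrightarrow>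
        norm ((\<Sum>(x,k)\<in>D. measure lborel k *\<^sub>R (indicator N x :: real)) - 0) < min \<delta> e'"
    unfolding has_integral_real by meson
  have "\<forall>t. \<exists>d>0. t \<in> {a..b} - N \<longrightarrow> (\<forall>p q. a \<le> p \<and> p \<le> t \<and> t \<le> q \<and> q \<le> b \<and> q - p < d \<longrightarrow> u q - u p \<le> e' * (q - p))"
    using straddle[OF _ e'] zero_less_one by metis
  then obtain d where d: "\<And>t. d t > 0"
    "\<And>t p q. t \<in> {a..b} - N \<Longrightarrow> a \<le> p \<Longrightarrow> p \<le> t \<Longrightarrow> t \<le> q \<Longrightarrow> q \<le> b \<Longrightarrow> q - p < d t \<Longrightarrow> u q - u p \<le> e' * (q - p)"
    by metis
  define g2 where "g2 t = ball t (d t / 2)" for t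
  have "gauge g2" using d(1) by (auto simp: g2_def gauge_def)
  with g1(1) have "gauge (\<lambda>t. g1 t \<inter> g2 t)" by (rule gauge_Int)
  then obtain D where D: "D tagged_division_of {a..b}" and "(\<lambda>t. g1 t \<inter> g2 t) fine D"
    using fine_division_exists_real by blast
  then have f1: "g1 fine D" and f2: "g2 fine D" by (auto simp: fine_Int)
  have fin: "finite D" using D by blast
  have k: "k = {Inf k..Sup k} \<and> a \<le> Inf k \<and> Inf k \<le> t \<and> t \<le> Sup k \<and> Sup k \<le> b \<and> measure lborel k = Sup k - Inf k"
    if tk: "(t, k) \<in> D" for t k
  proof -
    obtain p q where "k = {p..q}" using tagged_division_ofD(4)[OF D tk] by auto
    moreover have "t \<in> k" using tagged_division_ofD(2)[OF D tk] .
    ultimately show ?thesis using tagged_division_ofD(3)[OF D tk] by auto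
  qed
  define P where "P = {(t, k)\<in>D. t \<in> N}"
  have PD: "P \<subseteq> D" by (auto simp: P_def)
  \<comment> \<open>The total length of the intervals tagged in \<open>N\<close> is a Riemann sum of
    the indicator of \<open>N\<close>, hence close to its integral 0.\<close>
  have "(\<Sum>(t, k)\<in>P. Sup k - Inf k) = (\<Sum>(x,k)\<in>P. measure lborel k *\<^sub>R (indicator N x :: real))"
    by (rule sum.cong) (use k in \<open>auto simp: P_def\<close>)
  also have "\<dots> = (\<Sum>(x,k)\<in>D. measure lborel k *\<^sub>R (indicator N x :: real))"
    by (rule sum.mono_neutral_left[OF fin PD]) (auto simp: P_def indicator_def)
  also have "\<dots> < min \<delta> e'" using g1(2)[OF D f1] unfolding real_norm_def diff_zero by (rule order_le_less_trans[OF abs_ge_self])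
  finally have len: "(\<Sum>(t, k)\<in>P. Sup k - Inf k) < min \<delta> e'" .
  then have var: "(\<Sum>(t, k)\<in>P. norm (v (Sup k) - v (Inf k))) < e'"
    unfolding P_def by (intro tagged_division_AC_sum_small[OF \<delta>(2)[rule_format] D]) auto
  have P_part: "(\<Sum>(t, k)\<in>P. u (Sup k) - u (Inf k)) \<le> K * (2 * e')"
  proof -
    have "(\<Sum>(t, k)\<in>P. u (Sup k) - u (Inf k)) \<le>
      (\<Sum>(t, k)\<in>P. K * ((Sup k - Inf k) + norm (v (Sup k) - v (Inf k))))"
      by (rule sum_mono) (use k PD dom in force)
    also have "\<dots> = K * ((\<Sum>(t, k)\<in>P. Sup k - Inf k) + (\<Sum>(t, k)\<in>P. norm (v (Sup k) - v (Inf k))))"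
      by (simp add: sum_distrib_left sum.distrib case_prod_unfold distrib_left)
    also have "\<dots> \<le> K * (2 * e')" using len var K by (intro mult_left_mono) auto
    finally show ?thesis .
  qed
  have D_part: "(\<Sum>(t, k)\<in>D - P. u (Sup k) - u (Inf k)) \<le> e' * (b - a)"
  proof -
    have "(\<Sum>(t, k)\<in>D - P. u (Sup k) - u (Inf k)) \<le> (\<Sum>(t, k)\<in>D - P. e' * (Sup k - Inf k))"
    proof (rule sum_mono, clarify)
      fix t k assume "(t, k) \<in> D" "(t, k) \<notin> P"
      then have kk: "k = {Inf k..Sup k}" "a \<le> Inf k" "Inf k \<le> t" "t \<le> Sup k" "Sup k \<le> b" "t \<notin> N"
        using k[of t k] by (auto simp: P_def)
      have "k \<subseteq> ball t (d t / 2)" using f2 \<open>(t, k) \<in> D\<close> by (auto simp: fine_def g2_def)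
      moreover have "Inf k \<in> k" "Sup k \<in> k" using kk(1,3,4)
        by (metis atLeastAtMost_iff order_refl order_trans)+
      ultimately have "Inf k \<in> ball t (d t / 2)" "Sup k \<in> ball t (d t / 2)" by blast+
      then have "Sup k - Inf k < d t" unfolding mem_ball dist_real_def by linarith
      then show "u (Sup k) - u (Inf k) \<le> e' * (Sup k - Inf k)"
        using d(2)[of t "Inf k" "Sup k"] kk by auto
    qed
    also have "\<dots> \<le> (\<Sum>(t, k)\<in>D. e' * (Sup k - Inf k))"
      by (rule sum_mono2[OF fin]) (use k e' in force)+
    also have "\<dots> = e' * (b - a)"
      using additive_tagged_division_1[OF ab D, of "\<lambda>x. x"]
      by (simp add: sum_distrib_left[symmetric] case_prod_unfold)
    finally show ?thesis .
  qed
  have "u b - u a = (\<Sum>(t, k)\<in>D. u (Sup k) - u (Inf k))"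
    using additive_tagged_division_1[OF ab D, of u] by simp
  also have "\<dots> = (\<Sum>(t, k)\<in>D - P. u (Sup k) - u (Inf k)) + (\<Sum>(t, k)\<in>P. u (Sup k) - u (Inf k))"
    by (rule sum.subset_diff[OF PD fin])
  also have "\<dots> \<le> e' * (b - a) + K * (2 * e')" using P_part D_part by simp
  also have "\<dots> \<le> e' * (b - a + 2 * K + 1)" using e' by (simp add: algebra_simps)
  also have "\<dots> = e" using den by (simp add: e'_def)
  finally show "u b \<le> u a + e" by simp
qed

text \<open>A substitute for absolute continuity of \<open>u\<close> when \<open>v\<close> is absolutely continuous: boundedness is
  included so that the notion is closed under products.\<close>

definition dominated_by :: "(real \<Rightarrow> 'a::real_normed_vector) \<Rightarrow> real set \<Rightarrow> (real \<Rightarrow> 'b::real_normed_vector) \<Rightarrow> bool"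
  where "dominated_by v S u \<longleftrightarrow> bounded (u ` S) \<and>
    (\<exists>K\<ge>0. \<forall>p\<in>S. \<forall>q\<in>S. norm (u q - u p) \<le> K * (\<bar>q - p\<bar> + norm (v q - v p)))"

section \<open>Closure properties of domination\<close>

lemma dominated_byI:
  assumes "\<And>p. p \<in> S \<Longrightarrow> norm (u p) \<le> B"
    and "\<And>p q. p \<in> S \<Longrightarrow> q \<in> S \<Longrightarrow> norm (u q - u p) \<le> K * (\<bar>q - p\<bar> + norm (v q - v p))"
    and "K \<ge> 0"
  shows "dominated_by v S u"
  unfolding dominated_by_def bounded_iff
proof (intro conjI)
  show "\<exists>a. \<forall>y\<in>u ` S. norm y \<le> a" using assms(1) by (intro exI[of _ B]) blast
  show "\<exists>K\<ge>0. \<forall>p\<in>S. \<forall>q\<in>S. norm (u q - u p) \<le> K * (\<bar>q - p\<bar> + norm (v q - v p))"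
    using assms(2,3) by (intro exI[of _ K]) simp
qed

lemma dominated_byE:
  assumes "dominated_by v S u"
  obtains B K where "B \<ge> 0" "K \<ge> 0" "\<And>p. p \<in> S \<Longrightarrow> norm (u p) \<le> B"
    "\<And>p q. p \<in> S \<Longrightarrow> q \<in> S \<Longrightarrow> norm (u q - u p) \<le> K * (\<bar>q - p\<bar> + norm (v q - v p))"
proof -
  from assms obtain B K where *: "\<forall>y\<in>u ` S. norm y \<le> B" "K \<ge> 0"
    "\<forall>p\<in>S. \<forall>q\<in>S. norm (u q - u p) \<le> K * (\<bar>q - p\<bar> + norm (v q - v p))"
    unfolding dominated_by_def bounded_iff by blast
  show thesis
    by (rule that[of "max B 0" K]) (use * in \<open>auto simp: le_max_iff_disj\<close>)
qed

lemma dominated_by_const: "dominated_by v S (\<lambda>_. c)"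
  by (rule dominated_byI[where B = "norm c" and K = 0]) auto

lemma dominated_by_self:
  assumes "bounded (v ` S)" shows "dominated_by v S v"
  unfolding dominated_by_def using assms by (intro conjI exI[of _ 1]) auto

lemma dominated_by_add:
  assumes "dominated_by v S u" "dominated_by v S w"
  shows "dominated_by v S (\<lambda>t. u t + w t)"
proof -
  from dominated_byE[OF assms(1)] obtain B K where u: "B \<ge> 0" "K \<ge> 0" "\<And>p. p \<in> S \<Longrightarrow> norm (u p) \<le> B"
    "\<And>p q. p \<in> S \<Longrightarrow> q \<in> S \<Longrightarrow> norm (u q - u p) \<le> K * (\<bar>q - p\<bar> + norm (v q - v p))" by metis
  from dominated_byE[OF assms(2)] obtain C M where w: "C \<ge> 0" "M \<ge> 0" "\<And>p. p \<in> S \<Longrightarrow> norm (w p) \<le> C"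
    "\<And>p q. p \<in> S \<Longrightarrow> q \<in> S \<Longrightarrow> norm (w q - w p) \<le> M * (\<bar>q - p\<bar> + norm (v q - v p))" by metis
  show ?thesis
  proof (rule dominated_byI[where B = "B + C" and K = "K + M"])
    fix p q assume "p \<in> S" "q \<in> S"
    have "norm (u q + w q - (u p + w p)) = norm ((u q - u p) + (w q - w p))" by (simp add: algebra_simps)
    also have "\<dots> \<le> norm (u q - u p) + norm (w q - w p)" by (rule norm_triangle_ineq)
    also have "\<dots> \<le> (K + M) * (\<bar>q - p\<bar> + norm (v q - v p))"
      using u(4) w(4) \<open>p \<in> S\<close> \<open>q \<in> S\<close> by (simp add: distrib_right add_mono)
    finally show "norm (u q + w q - (u p + w p)) \<le> (K + M) * (\<bar>q - p\<bar> + norm (v q - v p))" .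
    show "norm (u p + w p) \<le> B + C" using u(3) w(3) \<open>p \<in> S\<close> by (simp add: norm_triangle_mono)
  qed (use u(2) w(2) in simp)
qed

lemma dominated_by_bilinear:
  assumes "bounded_bilinear h" "dominated_by v S u" "dominated_by v S w"
  shows "dominated_by v S (\<lambda>t. h (u t) (w t))"
proof -
  interpret bounded_bilinear h by fact
  from dominated_byE[OF assms(2)] obtain B K where u: "B \<ge> 0" "K \<ge> 0" "\<And>p. p \<in> S \<Longrightarrow> norm (u p) \<le> B"
    "\<And>p q. p \<in> S \<Longrightarrow> q \<in> S \<Longrightarrow> norm (u q - u p) \<le> K * (\<bar>q - p\<bar> + norm (v q - v p))" by metis
  from dominated_byE[OF assms(3)] obtain C M where w: "C \<ge> 0" "M \<ge> 0" "\<And>p. p \<in> S \<Longrightarrow> norm (w p) \<le> C"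
    "\<And>p q. p \<in> S \<Longrightarrow> q \<in> S \<Longrightarrow> norm (w q - w p) \<le> M * (\<bar>q - p\<bar> + norm (v q - v p))" by metis
  from pos_bounded obtain H where H: "H > 0" "\<And>x y. norm (h x y) \<le> norm x * norm y * H" by metis
  have bd: "norm (h x y) \<le> X * Y * H" if "norm x \<le> X" "norm y \<le> Y" for x y X Y
  proof -
    have "norm x * norm y * H \<le> X * Y * H"
      using that H(1) by (intro mult_right_mono mult_mono) (auto intro: order_trans[OF norm_ge_zero])
    then show ?thesis using H(2) order_trans by blast
  qed
  show ?thesis
  proof (rule dominated_byI[where B = "B * C * H" and K = "K * C * H + B * M * H"])
    fix p q assume pq: "p \<in> S" "q \<in> S"
    let ?r = "\<bar>q - p\<bar> + norm (v q - v p)"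
    have "norm (h (u q) (w q) - h (u p) (w p)) = norm (h (u q - u p) (w q) + h (u p) (w q - w p))"
      by (simp add: diff_left diff_right)
    also have "\<dots> \<le> (K * ?r) * C * H + B * (M * ?r) * H"
      by (intro norm_triangle_mono bd u w pq)
    finally show "norm (h (u q) (w q) - h (u p) (w p)) \<le> (K * C * H + B * M * H) * ?r"
      by (simp add: algebra_simps)
    show "norm (h (u p) (w p)) \<le> B * C * H" by (intro bd u w pq)
  qed (use u(1,2) w(1,2) H(1) in simp)
qed

lemmas dominated_by_inner = dominated_by_bilinear[OF bounded_bilinear_inner]
lemmas dominated_by_mult = dominated_by_bilinear[OF bounded_bilinear_mult]

text \<open>On a compact interval such a function is Lipschitz, so the \<open>|q - p|\<close> term
  alone suffices, whatever \<open>v\<close> is.\<close>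

lemma dominated_by_C1:
  fixes u :: "real \<Rightarrow> 'b::real_normed_vector"
  assumes der: "\<And>t. t \<in> {a..b} \<Longrightarrow> (u has_vector_derivative u' t) (at t within {a..b})"
    and cont: "continuous_on {a..b} u'"
  shows "dominated_by v {a..b} u"
proof -
  have "continuous_on {a..b} u"
    using der has_vector_derivative_continuous continuous_on_eq_continuous_within by blast
  then have "bounded (u ` {a..b})" using compact_continuous_image compact_imp_bounded by blast
  moreover have "bounded (u' ` {a..b})" using cont compact_continuous_image compact_imp_bounded by blast
  ultimately obtain B K where B: "\<And>t. t \<in> {a..b} \<Longrightarrow> norm (u t) \<le> B"
    and K: "K > 0" "\<And>t. t \<in> {a..b} \<Longrightarrow> norm (u' t) \<le> K"
    unfolding bounded_pos by (meson imageI)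
  show ?thesis
  proof (rule dominated_byI[where B = B and K = K])
    fix p q assume pq: "p \<in> {a..b}" "q \<in> {a..b}"
    have "norm (u q - u p) \<le> K * norm (q - p)"
    proof (rule differentiable_bound[OF _ _ _ pq(2) pq(1)])
      show "convex {a..b}" by simp
      show "(u has_derivative (\<lambda>h. h *\<^sub>R u' t)) (at t within {a..b})" if "t \<in> {a..b}" for t
        using der[OF that] by (simp add: has_vector_derivative_def)
      show "onorm (\<lambda>h. h *\<^sub>R u' t) \<le> K" if "t \<in> {a..b}" for t
        using K(2)[OF that] by (intro onorm_le) (simp add: mult.commute[of K] mult_left_mono)
    qed
    also have "\<dots> \<le> K * (\<bar>q - p\<bar> + norm (v q - v p))" using K(1) by simp
    finally show "norm (u q - u p) \<le> K * (\<bar>q - p\<bar> + norm (v q - v p))" .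
    show "norm (u p) \<le> B" using B pq(1) .
  qed (use K(1) in simp)
qed

section \<open>Minima of finitely many dominated functions\<close>

lemma Min_range_le: "(MIN i. g i) \<le> g j" for g :: "'m::finite \<Rightarrow> 'b::linorder"
  by simp

lemma Min_range_obtain:
  fixes g :: "'m::finite \<Rightarrow> 'b::linorder"
  obtains j where "(MIN i. g i) = g j"
proof -
  have "(MIN i. g i) \<in> range g" by (rule Min_in) auto
  then show thesis using that by (rule imageE) blast
qed

text \<open>The index attaining the minimum at \<open>p\<close> reduces the increment of the minimum
  to that of one member; the sum of all constants serves every index. The bound is one-sided, as in
  the hypothesis \<open>dom\<close> of \<open>AC_dominated_straddle_le\<close>.\<close>

lemma dominated_Min_increment:
  fixes a :: "'m::finite \<Rightarrow> real \<Rightarrow> real"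
  assumes "\<And>j. dominated_by v S (a j)"
  shows "\<exists>K\<ge>0. \<forall>p\<in>S. \<forall>q\<in>S.
    (MIN j. a j q) - (MIN j. a j p) \<le> K * (\<bar>q - p\<bar> + norm (v q - v p))"
proof -
  have "\<forall>j. \<exists>K. K \<ge> 0 \<and> (\<forall>p\<in>S. \<forall>q\<in>S. norm (a j q - a j p) \<le> K * (\<bar>q - p\<bar> + norm (v q - v p)))"
    using assms unfolding dominated_by_def by blast
  then obtain K where K: "\<And>j. K j \<ge> 0"
    "\<And>j p q. p \<in> S \<Longrightarrow> q \<in> S \<Longrightarrow> norm (a j q - a j p) \<le> K j * (\<bar>q - p\<bar> + norm (v q - v p))"
    by metis
  show ?thesis
  proof (intro exI[of _ "\<Sum>j\<in>UNIV. K j"] conjI ballI)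
    show "(\<Sum>j\<in>UNIV. K j) \<ge> 0" by (simp add: K sum_nonneg)
    fix p q assume pq: "p \<in> S" "q \<in> S"
    obtain j where j: "(MIN i. a i p) = a j p" by (rule Min_range_obtain)
    have "(MIN i. a i q) - (MIN i. a i p) \<le> a j q - a j p"
      unfolding j using Min_range_le[of "\<lambda>i. a i q" j] by simp
    also have "\<dots> \<le> K j * (\<bar>q - p\<bar> + norm (v q - v p))"
      using K(2)[OF pq, of j] by simp
    also have "\<dots> \<le> (\<Sum>j\<in>UNIV. K j) * (\<bar>q - p\<bar> + norm (v q - v p))"
      by (intro mult_right_mono member_le_sum) (auto simp: K)
    finally show "(MIN i. a i q) - (MIN i. a i p) \<le> (\<Sum>j\<in>UNIV. K j) * (\<bar>q - p\<bar> + norm (v q - v p))" .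
  qed
qed

text \<open>Since \<open>t\<close> lies between \<open>p\<close> and \<open>q\<close>, the first
  order errors \<open>e * (t - p)\<close> and \<open>e * (q - t)\<close> add up to
  \<open>e * (q - p)\<close>.\<close>

lemma has_real_derivative_straddle:
  fixes a :: "real \<Rightarrow> real"
  assumes der: "(a has_real_derivative D) (at t within S)" and "t \<in> S" and e: "e > 0"
  shows "\<exists>d>0. \<forall>p\<in>S. \<forall>q\<in>S. p \<le> t \<and> t \<le> q \<and> q - p < d \<longrightarrow> a q - a p \<le> (D + e) * (q - p)"
proof -
  from der[unfolded has_field_derivative_def has_derivative_within_alt, THEN conjunct2, rule_format, OF e]
  obtain d where d: "d > 0" "\<And>y. y \<in> S \<Longrightarrow> norm (y - t) < d \<Longrightarrow> norm (a y - a t - D * (y - t)) \<le> e * norm (y - t)"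
    by blast
  show ?thesis
  proof (intro exI[of _ d] conjI ballI impI d)
    fix p q assume pq: "p \<in> S" "q \<in> S" "p \<le> t \<and> t \<le> q \<and> q - p < d"
    then have "a q - a t - D * (q - t) \<le> e * (q - t)" "- (a p - a t - D * (p - t)) \<le> e * (t - p)"
      using d(2)[of p] d(2)[of q] by (auto simp: abs_le_iff)
    then show "a q - a p \<le> (D + e) * (q - p)" by (simp add: algebra_simps)
  qed
qed

text \<open>An index inactive at \<open>t\<close> stays strictly above some active one near
  \<open>t\<close> by continuity, so it cannot attain the minimum at a nearby \<open>p\<close>.
  Hence a sign condition at the active indices is enough.\<close>

lemma Min_active_straddle:
  fixes a :: "'m::finite \<Rightarrow> real \<Rightarrow> real"
  assumes der: "\<And>j. (a j has_real_derivative D j) (at t within S)"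
    and active: "\<And>j. a j t = (MIN i. a i t) \<Longrightarrow> D j \<le> 0"
    and t: "t \<in> S" and e: "e > 0"
  shows "\<exists>d>0. \<forall>p\<in>S. \<forall>q\<in>S. p \<le> t \<and> t \<le> q \<and> q - p < d \<longrightarrow>
    (MIN j. a j q) - (MIN j. a j p) \<le> e * (q - p)"
proof -
  have "\<exists>d>0. \<forall>p\<in>S. \<forall>q\<in>S. p \<le> t \<and> t \<le> q \<and> q - p < d \<and> (MIN i. a i p) = a j p \<longrightarrow>
     a j q - a j p \<le> e * (q - p)" for j
  proof (cases "a j t = (MIN i. a i t)")
    case True
    obtain d where d: "d > 0" "\<And>p q. p \<in> S \<Longrightarrow> q \<in> S \<Longrightarrow> p \<le> t \<and> t \<le> q \<and> q - p < d \<Longrightarrow> a j q - a j p \<le> (D j + e) * (q - p)"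
      using has_real_derivative_straddle[OF der t e] by blast
    have "(D j + e) * (q - p) \<le> e * (q - p)" if "p \<le> t" "t \<le> q" for p q
      using active[OF True] that by (intro mult_right_mono) auto
    with d show ?thesis by (meson order_trans)
  next
    case False
    obtain i where i: "(MIN i. a i t) = a i t" by (rule Min_range_obtain)
    have "a i t < a j t" using False Min_range_le[of "\<lambda>i. a i t" j] unfolding i by simp
    moreover have "((\<lambda>s. a j s - a i s) \<longlongrightarrow> a j t - a i t) (at t within S)"
      using der DERIV_continuous continuous_within by (intro tendsto_diff) blast+
    ultimately have "eventually (\<lambda>s. a j s - a i s > 0) (at t within S)"
      by (intro order_tendstoD) auto
    then obtain d where d: "d > 0" "\<And>s. s \<in> S \<Longrightarrow> s \<noteq> t \<Longrightarrow> dist s t < d \<Longrightarrow> a j s - a i s > 0"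
      unfolding eventually_at by blast
    have "(MIN i. a i p) \<noteq> a j p" if "p \<in> S" "p \<le> t" "t \<le> q" "q - p < d" for p q
    proof -
      have "a i p < a j p"
        using d(2)[of p] that \<open>a i t < a j t\<close> by (cases "p = t") (auto simp: dist_real_def)
      then show ?thesis using Min_range_le[of "\<lambda>i. a i p" i] by linarith
    qed
    with d(1) show ?thesis by blast
  qed
  then obtain d where d: "\<And>j. d j > 0" "\<And>j p q. p \<in> S \<Longrightarrow> q \<in> S \<Longrightarrow>
     p \<le> t \<and> t \<le> q \<and> q - p < d j \<and> (MIN i. a i p) = a j p \<Longrightarrow> a j q - a j p \<le> e * (q - p)"
    by metis
  show ?thesis
  proof (intro exI[of _ "MIN j. d j"] conjI ballI impI)
    show "0 < (MIN j. d j)" using d(1) by simp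
    fix p q assume pq: "p \<in> S" "q \<in> S" "p \<le> t \<and> t \<le> q \<and> q - p < (MIN j. d j)"
    obtain j where j: "(MIN i. a i p) = a j p" by (rule Min_range_obtain)
    have "(MIN i. a i q) - (MIN i. a i p) \<le> a j q - a j p"
      unfolding j using Min_range_le[of "\<lambda>i. a i q" j] by simp
    also have "\<dots> \<le> e * (q - p)"
      using pq j Min_range_le[of d j] by (intro d(2)) auto
    finally show "(MIN j. a j q) - (MIN j. a j p) \<le> e * (q - p)" .
  qed
qed

text \<open>The form used for the Lyapunov function: \<open>a j\<close> is the weighted energy with
  the single objective \<open>j\<close> in place of the minimum, and the sign of its derivative is
  known only while \<open>j\<close> is active.\<close>

lemma Min_AC_decreasing:
  fixes a D :: "'m::finite \<Rightarrow> real \<Rightarrow> real" and v :: "real \<Rightarrow> 'a::real_normed_vector"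
  assumes T: "s \<le> T" and ac: "abs_continuous_on {s..T} v" and N: "negligible N"
    and dom: "\<And>j. dominated_by v {s..T} (a j)"
    and der: "\<And>t j. t \<in> {s..T} - N \<Longrightarrow> (a j has_real_derivative D j t) (at t within {s..T})"
    and active: "\<And>t j. t \<in> {s..T} - N \<Longrightarrow> a j t = (MIN i. a i t) \<Longrightarrow> D j t \<le> 0"
  shows "(MIN j. a j T) \<le> (MIN j. a j s)"
proof -
  obtain K where K: "K \<ge> 0" "\<And>p q. p \<in> {s..T} \<Longrightarrow> q \<in> {s..T} \<Longrightarrow>
    (MIN j. a j q) - (MIN j. a j p) \<le> K * (\<bar>q - p\<bar> + norm (v q - v p))"
    using dominated_Min_increment[where a = a, OF dom] by blast
  show ?thesis
  proof (rule AC_dominated_straddle_le[where u = "\<lambda>t. MIN j. a j t", OF T ac N _ K(1)])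
    fix p q assume "s \<le> p" "p \<le> q" "q \<le> T"
    then show "(MIN j. a j q) - (MIN j. a j p) \<le> K * (q - p + norm (v q - v p))"
      using K(2)[of p q] by simp
  next
    fix t e :: real assume t: "t \<in> {s..T} - N" and e: "e > 0"
    have "\<exists>d>0. \<forall>p\<in>{s..T}. \<forall>q\<in>{s..T}. p \<le> t \<and> t \<le> q \<and> q - p < d \<longrightarrow>
      (MIN j. a j q) - (MIN j. a j p) \<le> e * (q - p)"
      by (rule Min_active_straddle[OF der[OF t] active[OF t] _ e]) (use t in auto)
    then obtain d where d: "d > 0" "\<And>p q. p \<in> {s..T} \<Longrightarrow> q \<in> {s..T} \<Longrightarrow> p \<le> t \<and> t \<le> q \<and> q - p < d \<Longrightarrow>
      (MIN j. a j q) - (MIN j. a j p) \<le> e * (q - p)" by blast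
    show "\<exists>d>0. \<forall>p q. s \<le> p \<and> p \<le> t \<and> t \<le> q \<and> q \<le> T \<and> q - p < d \<longrightarrow> (MIN j. a j q) - (MIN j. a j p) \<le> e * (q - p)"
      by (intro exI[of _ d] conjI allI impI d) auto
  qed
qed

section \<open>Gradients of smooth convex objectives\<close>

text \<open>The adjoint of a linear functional, applied to 1, is its Riesz representative.\<close>

lemma has_derivative_imp_GDERIV:
  fixes f :: "'a::euclidean_space \<Rightarrow> real"
  assumes "(f has_derivative f') (at x)"
  shows "GDERIV f x :> adjoint f' 1"
proof -
  have "linear f'" using assms has_derivative_linear by blast
  then have "f' = (\<lambda>h. h \<bullet> adjoint f' 1)" by (simp add: adjoint_works)
  then show ?thesis using assms unfolding gderiv_def by simp
qed

lemma GDERIV_unique: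
  assumes "GDERIV f x :> D" "GDERIV f x :> E" shows "D = E"
proof -
  have "(\<lambda>h. h \<bullet> D) = (\<lambda>h. h \<bullet> E)"
    using assms unfolding gderiv_def by (rule has_derivative_unique)
  then have "(D - E) \<bullet> (D - E) = 0" by (metis inner_diff_right right_minus_eq)
  then show ?thesis by simp
qed

lemma GDERIV_grad:
  fixes f :: "'a::euclidean_space \<Rightarrow> real"
  assumes "f differentiable (at x)"
  shows "GDERIV f x :> grad f x"
proof -
  obtain f' where "(f has_derivative f') (at x)" using assms by (auto simp: differentiable_def)
  note * = has_derivative_imp_GDERIV[OF this]
  show ?thesis unfolding grad_def by (rule theI[where P = "\<lambda>D. GDERIV f x :> D", OF *]) (use * GDERIV_unique in blast)
qed

lemma GDERIV_chain_within:
  assumes "GDERIV f (x t) :> D" "(x has_vector_derivative d) (at t within S)"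
  shows "((\<lambda>t. f (x t)) has_real_derivative D \<bullet> d) (at t within S)"
  unfolding has_field_derivative_def
  by (rule has_derivative_eq_rhs[OF has_derivative_compose[OF
      assms(2)[unfolded has_vector_derivative_def] assms(1)[unfolded gderiv_def]]])
    (auto simp: inner_commute mult.commute)

lemma has_real_derivative_inner:
  fixes u w :: "real \<Rightarrow> 'a::real_inner"
  assumes "(u has_vector_derivative u') (at t within S)" "(w has_vector_derivative w') (at t within S)"
  shows "((\<lambda>t. u t \<bullet> w t) has_real_derivative (u t \<bullet> w' + u' \<bullet> w t)) (at t within S)"
  using bounded_bilinear.has_vector_derivative[OF bounded_bilinear_inner assms]
  by (simp add: has_real_derivative_iff_has_vector_derivative)

lemma abs_continuous_on_imp_continuous_on:
  fixes v :: "real \<Rightarrow> 'a::real_normed_vector"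
  assumes ac: "abs_continuous_on {a..b} v"
  shows "continuous_on {a..b} v"
  unfolding continuous_on_iff
proof (intro ballI allI impI)
  fix t e :: real assume t: "t \<in> {a..b}" and e: "e > 0"
  from abs_continuous_onD[OF ac e] obtain \<delta> where \<delta>: "\<delta> > 0"
    "\<forall>I. finite I \<longrightarrow> (\<forall>p q. (p, q) \<in> I \<longrightarrow> p \<le> q \<and> {p..q} \<subseteq> {a..b}) \<longrightarrow>
       disjoint_family_on (\<lambda>(p, q). {p<..<q}) I \<longrightarrow> (\<Sum>(p, q)\<in>I. q - p) < \<delta> \<longrightarrow>
       (\<Sum>(p, q)\<in>I. norm (v q - v p)) < e" by blast
  have "dist (v s) (v t) < e" if s: "s \<in> {a..b}" "dist s t < \<delta>" for s
  proof -
    let ?p = "min s t" and ?q = "max s t"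
    have sub: "{?p..?q} \<subseteq> {a..b}" using t s(1) by auto
    have "(\<Sum>(p, q)\<in>{(?p, ?q)}. norm (v q - v p)) < e"
    proof (rule \<delta>(2)[rule_format])
      show "p \<le> q \<and> {p..q} \<subseteq> {a..b}" if "(p, q) \<in> {(?p, ?q)}" for p q
        using that sub by simp
      show "(\<Sum>(p, q)\<in>{(?p, ?q)}. q - p) < \<delta>" using s(2) by (simp add: dist_real_def)
    qed (simp_all add: disjoint_family_on_def)
    then have "norm (v ?q - v ?p) < e" by simp
    then show ?thesis by (cases "s \<le> t") (simp_all add: dist_norm norm_minus_commute min_def max_def)
  qed
  then show "\<exists>d>0. \<forall>s\<in>{a..b}. dist s t < d \<longrightarrow> dist (v s) (v t) < e"
    using \<delta>(1) by (intro exI[of _ \<delta>]) simp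
qed

locale smooth_convex_objectives =
  fixes f :: "'m::finite \<Rightarrow> real^'n \<Rightarrow> real" and \<mu>f Lf :: "'m \<Rightarrow> real" and \<mu> L :: real
  assumes differentiable: "\<And>j. f j differentiable_on UNIV"
    and smooth: "\<And>j. (Lf j)-lipschitz_on UNIV (grad (f j))"
    and convex_modulus: "\<And>j x y. f j y - f j x - grad (f j) x \<bullet> (y - x) \<ge> \<mu>f j / 2 * (norm (x - y))\<^sup>2"
    and moduli: "\<And>j. 0 \<le> \<mu>f j" "\<And>j. \<mu>f j \<le> Lf j"
    and mu_def: "\<mu> = (MIN j. \<mu>f j)"
    and L_def: "L = (MAX j. Lf j)"
begin

abbreviation G where "G \<equiv> MAX j. norm (grad (f j) 0)"

lemma gderiv_grad: "GDERIV (f j) y :> grad (f j) y"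
  using differentiable by (intro GDERIV_grad) (auto simp: differentiable_on_def)

lemma continuous_grad: "continuous_on S (grad (f j))"
  by (rule continuous_on_subset[OF lipschitz_on_continuous_on[OF smooth] subset_UNIV])

lemma continuous_objective: "continuous_on S (f j)"
  by (rule continuous_on_subset[OF differentiable_imp_continuous_on[OF differentiable] subset_UNIV])

lemma mu_le: "\<mu> \<le> \<mu>f j" and Lf_le: "Lf j \<le> L" and G_ge: "norm (grad (f j) 0) \<le> G"
  unfolding mu_def L_def by auto

lemma mu_nonneg: "0 \<le> \<mu>" and L_nonneg: "0 \<le> L" and G_nonneg: "0 \<le> G"
proof -
  show "0 \<le> \<mu>" unfolding mu_def using moduli(1) by simp
  show "0 \<le> L" using moduli[of undefined] Lf_le[of undefined] by simp
  show "0 \<le> G" by (rule order_trans[OF norm_ge_zero G_ge])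
qed

lemma strong_convexity: "grad (f j) x \<bullet> (y - x) \<le> f j y - f j x - \<mu> / 2 * (norm (x - y))\<^sup>2"
proof -
  have "\<mu> / 2 * (norm (x - y))\<^sup>2 \<le> \<mu>f j / 2 * (norm (x - y))\<^sup>2"
    using mu_le[of j] by (intro mult_right_mono) simp_all
  then show ?thesis using convex_modulus[where j = j and y = y and x = x] by linarith
qed

lemma gradient_inequality: "f j y - f j x \<le> grad (f j) y \<bullet> (y - x)"
proof -
  have "grad (f j) y \<bullet> (x - y) \<le> f j x - f j y"
    using strong_convexity[of j y x] mu_nonneg
    by (intro order_trans[OF strong_convexity]) (simp del: norm_ge_zero)
  then show ?thesis by (simp add: inner_diff_right)
qed

lemma norm_grad_le: "norm (grad (f j) y) \<le> G + L * norm y"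
proof -
  have "norm (grad (f j) y - grad (f j) 0) \<le> Lf j * norm y"
    using lipschitz_onD[OF smooth, of y 0 j] by (simp add: dist_norm)
  also have "\<dots> \<le> L * norm y" using Lf_le by (intro mult_right_mono) auto
  finally show ?thesis
    using G_ge[of j] norm_triangle_ineq2[of "grad (f j) y" "grad (f j) 0"] by linarith
qed

lemma objective_diff_le: "f j y - f j z \<le> (G + L * norm y) * (norm y + norm z)"
proof -
  have "f j y - f j z \<le> norm (grad (f j) y) * norm (y - z)"
    by (rule order_trans[OF gradient_inequality norm_cauchy_schwarz])
  also have "\<dots> \<le> (G + L * norm y) * (norm y + norm z)"
    by (intro mult_mono norm_grad_le norm_triangle_ineq4 add_nonneg_nonneg mult_nonneg_nonneg
        G_nonneg L_nonneg norm_ge_zero)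
  finally show ?thesis .
qed

lemma objective_diff_le_C1: "f j y - f j x0 \<le> C1 f L x0 (norm y)"
proof -
  \<comment> \<open>\<open>C1\<close> exceeds the bound with the gradient at \<open>y\<close> by
    exactly \<open>2 * (L * (norm x0)^2)\<close>, the price of replacing \<open>L * norm y\<close>
    by \<open>L * norm x0\<close> in its first factor.\<close>
  have "(G + L * norm y) * (norm y + norm x0) + 2 * (L * (norm x0)\<^sup>2) = C1 f L x0 (norm y)"
    unfolding C1_def by (simp add: algebra_simps power2_eq_square)
  moreover have "0 \<le> L * (norm x0)\<^sup>2" using L_nonneg by simp
  ultimately show ?thesis using objective_diff_le[of j y x0] by linarith
qed

lemma grad_in_hull: "grad (f j) y \<in> grad_hull f y"
  unfolding grad_hull_def by (rule hull_inc) simp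

text \<open>Strong convexity gives the bound at each single gradient; it describes a half-space, so
  it passes to the convex hull.\<close>

lemma hull_inner_le:
  assumes g: "g \<in> grad_hull f y" and m: "\<And>j. m \<le> f j y - f j z"
  shows "g \<bullet> (z - y) \<le> - m - \<mu> / 2 * (norm (y - z))\<^sup>2"
proof -
  have "range (\<lambda>j. grad (f j) y) \<subseteq> {g. g \<bullet> (z - y) \<le> - m - \<mu> / 2 * (norm (y - z))\<^sup>2}"
  proof clarify
    fix j
    show "grad (f j) y \<bullet> (z - y) \<le> - m - \<mu> / 2 * (norm (y - z))\<^sup>2"
      using strong_convexity[of j y z] m[of j] by linarith
  qed
  moreover have "convex {g. g \<bullet> (z - y) \<le> - m - \<mu> / 2 * (norm (y - z))\<^sup>2}"
    unfolding inner_commute[of _ "z - y"] by (rule convex_halfspace_le)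
  ultimately have "grad_hull f y \<subseteq> {g. g \<bullet> (z - y) \<le> - m - \<mu> / 2 * (norm (y - z))\<^sup>2}"
    unfolding grad_hull_def by (rule hull_minimal)
  with g show ?thesis by blast
qed

lemma C1_mono: "0 \<le> s \<Longrightarrow> s \<le> t \<Longrightarrow> C1 f L x0 s \<le> C1 f L x0 t"
  unfolding C1_def using G_nonneg L_nonneg
  by (intro add_mono mult_left_mono power_mono) simp_all

end

text \<open>The multipliers drop out of this sum because \<open>z\<close> is feasible; what remains is
  \<open>- \<mu>/2 * norm (x - v)^2\<close>.\<close>

lemma lyapunov_dissipation:
  fixes A :: "real^'n^'r" and x v z g g' d :: "real^'n"
  assumes z: "A *v z = b"
    and theta: "\<theta> *\<^sub>R e = A *v v - b"
    and gamma: "\<gamma> *\<^sub>R d = \<mu> *\<^sub>R (x - v) - transpose A *v \<xi> - g"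
    and max: "g' \<bullet> (v - x) \<le> g \<bullet> (v - x)"
    and conv: "g \<bullet> (z - x) \<le> - m - \<mu> / 2 * (norm (x - z))\<^sup>2"
    and mu: "\<mu> \<ge> 0"
  shows "m + (\<eta> \<bullet> (A *v x - b) + \<gamma> / 2 * ((v - z) \<bullet> (v - z)) + \<theta> / 2 * ((\<xi> - \<eta>) \<bullet> (\<xi> - \<eta>)))
    + (g' \<bullet> (v - x) + (\<eta> \<bullet> (A *v (v - x)) + (\<mu> - \<gamma>) / 2 * ((v - z) \<bullet> (v - z))
       + \<gamma> * ((v - z) \<bullet> d) - \<theta> / 2 * ((\<xi> - \<eta>) \<bullet> (\<xi> - \<eta>)) + \<theta> * ((\<xi> - \<eta>) \<bullet> e))) \<le> 0"
proof -
  define X V w where "X = x - z" and "V = v - z" and "w = \<xi> - \<eta>"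
  have AX: "A *v x - b = A *v X" and AV: "A *v v - b = A *v V" and vx: "v - x = V - X" "x - v = X - V"
    and xz: "z - x = - X" "x - z = X"
    by (simp_all add: X_def V_def z[symmetric] matrix_vector_mult_diff_distrib)
  \<comment> \<open>The terms \<open>\<xi> \<bullet> (A *v V)\<close> and
    \<open>g \<bullet> V\<close> produced here cancel against those in 2 and 4.\<close>
  have 1: "\<gamma> * (V \<bullet> d) = \<mu> * (V \<bullet> X) - \<mu> * (V \<bullet> V) - \<xi> \<bullet> (A *v V) - g \<bullet> V"
  proof -
    have "\<gamma> * (V \<bullet> d) = V \<bullet> (\<gamma> *\<^sub>R d)" by simp
    also have "\<dots> = \<mu> * (V \<bullet> X) - \<mu> * (V \<bullet> V) - (transpose A *v \<xi>) \<bullet> V - g \<bullet> V"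
      unfolding gamma vx by (simp add: inner_diff_right inner_commute algebra_simps)
    also have "(transpose A *v \<xi>) \<bullet> V = \<xi> \<bullet> (A *v V)" by (simp add: dot_lmul_matrix)
    finally show ?thesis .
  qed
  have 2: "\<theta> * (w \<bullet> e) = \<xi> \<bullet> (A *v V) - \<eta> \<bullet> (A *v V)"
  proof -
    have "\<theta> * (w \<bullet> e) = w \<bullet> (\<theta> *\<^sub>R e)" by simp
    also have "\<dots> = \<xi> \<bullet> (A *v V) - \<eta> \<bullet> (A *v V)" unfolding theta AV w_def by (simp add: inner_diff_left)
    finally show ?thesis .
  qed
  have 3: "\<eta> \<bullet> (A *v (v - x)) = \<eta> \<bullet> (A *v V) - \<eta> \<bullet> (A *v X)"
    unfolding vx by (simp add: matrix_vector_mult_diff_distrib inner_diff_right)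
  have 4: "g' \<bullet> (v - x) \<le> g \<bullet> V - g \<bullet> X" using max unfolding vx by (simp add: inner_diff_right)
  have 5: "- (g \<bullet> X) \<le> - m - \<mu> / 2 * (X \<bullet> X)"
    using conv unfolding xz by (simp add: power2_norm_eq_inner)
  have 6: "0 \<le> \<mu> / 2 * (X \<bullet> X) - \<mu> * (V \<bullet> X) + \<mu> / 2 * (V \<bullet> V)"
  proof -
    have "0 \<le> \<mu> / 2 * ((X - V) \<bullet> (X - V))" using mu by simp
    also have "\<dots> = \<mu> / 2 * (X \<bullet> X) - \<mu> * (V \<bullet> X) + \<mu> / 2 * (V \<bullet> V)"
      by (simp add: inner_diff_left inner_diff_right inner_commute algebra_simps)
    finally show ?thesis .
  qed
  have 7: "(\<mu> - \<gamma>) / 2 * (V \<bullet> V) = \<mu> / 2 * (V \<bullet> V) - \<gamma> / 2 * (V \<bullet> V)"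
    by (simp add: field_simps)
  show ?thesis
    unfolding AX V_def[symmetric] w_def[symmetric]
    using 1 2 3 4 5 6 7 by linarith
qed

section \<open>Smallest nonzero singular value and error bound\<close>

lemma inner_gram: "((transpose A ** A) *v u) \<bullet> w = (A *v u) \<bullet> (A *v w)" for A :: "real^'n^'r"
  by (simp add: matrix_vector_mul_assoc[symmetric] dot_lmul_matrix del: transpose_matrix_vector)
    (metis dot_lmul_matrix transpose_matrix_vector)

text \<open>The Gram matrix is symmetric, so eigenvectors for distinct eigenvalues are orthogonal,
  hence independent, hence finite in number. Only then does the \<open>Min\<close> in
  \<open>sigma_min_pos\<close> denote a least element.\<close>

lemma finite_singular_values: "finite (singular_values A)" for A :: "real^'n^'r"
proof -
  define M where "M = transpose A ** A"
  define E where "E = {l. \<exists>u. u \<noteq> 0 \<and> M *v u = l *\<^sub>R u}"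
  have "\<forall>l\<in>E. \<exists>u. u \<noteq> 0 \<and> M *v u = l *\<^sub>R u" by (simp add: E_def)
  then obtain e where e: "\<And>l. l \<in> E \<Longrightarrow> e l \<noteq> 0" "\<And>l. l \<in> E \<Longrightarrow> M *v e l = l *\<^sub>R e l"
    by metis
  have orth: "e l \<bullet> e k = 0" if "l \<in> E" "k \<in> E" "l \<noteq> k" for l k
  proof -
    have "l * (e l \<bullet> e k) = (M *v e l) \<bullet> e k" using e(2)[OF that(1)] by simp
    also have "\<dots> = (M *v e k) \<bullet> e l" unfolding M_def inner_gram by (rule inner_commute)
    also have "\<dots> = k * (e l \<bullet> e k)" using e(2)[OF that(2)] by (simp add: inner_commute)
    finally show ?thesis using that(3) by simp
  qed
  have "pairwise orthogonal (e ` E)"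
    unfolding pairwise_def orthogonal_def using orth by blast
  moreover have "0 \<notin> e ` E" using e(1) by (metis imageE)
  ultimately have "finite (e ` E)"
    by (intro finiteI_independent pairwise_orthogonal_independent)
  moreover have "inj_on e E"
  proof (rule inj_onI, rule ccontr)
    fix l k assume lk: "l \<in> E" "k \<in> E" "e l = e k" "l \<noteq> k"
    then have "e l \<bullet> e l = 0" using orth[of l k] by simp
    then show False using e(1)[OF lk(1)] by simp
  qed
  ultimately have "finite E" by (rule finite_imageD)
  moreover have "singular_values A = sqrt ` E" unfolding singular_values_def E_def M_def by auto
  ultimately show ?thesis by simp
qed

lemma singular_value_nonneg: "s \<in> singular_values A \<Longrightarrow> 0 \<le> s" for A :: "real^'n^'r"
proof -
  assume "s \<in> singular_values A"
  then obtain l u where *: "s = sqrt l" "u \<noteq> 0" "(transpose A ** A) *v u = l *\<^sub>R u"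
    unfolding singular_values_def by blast
  then have "l * (u \<bullet> u) = (A *v u) \<bullet> (A *v u)" using inner_gram[of A u u] by simp
  then have "0 \<le> l * (u \<bullet> u)" by simp
  moreover have "u \<bullet> u > 0" using *(2) by simp
  ultimately show ?thesis using *(1) by (simp add: zero_le_mult_iff)
qed

text \<open>A Rayleigh quotient argument on the orthogonal complement \<open>W\<close> of the
  kernel: \<open>norm (A *v u)\<close> attains its minimum over the unit vectors of \<open>W\<close>
  at some \<open>u0\<close>, minimality makes \<open>u0\<close> an eigenvector of the Gram matrix,
  and so the minimum is itself a nonzero singular value, at least
  \<open>sigma_min_pos A\<close>.\<close>

lemma sigma_min_pos:
  fixes A :: "real^'n^'r"
  assumes "A \<noteq> 0"
  shows "sigma_min_pos A > 0"
    and "(\<And>w. A *v w = 0 \<Longrightarrow> u \<bullet> w = 0) \<Longrightarrow> sigma_min_pos A * norm u \<le> norm (A *v u)"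
proof -
  define W where "W = {u. \<forall>w. A *v w = 0 \<longrightarrow> u \<bullet> w = 0}"
  have gram_W: "(transpose A ** A) *v y \<in> W" for y
    unfolding W_def mem_Collect_eq inner_gram by simp
  have lin_W: "x + c *\<^sub>R y \<in> W" if "x \<in> W" "y \<in> W" for x y c
    using that by (simp add: W_def inner_add_left)
  have zero_W: "0 \<in> W" by (simp add: W_def)
  have scale_W: "c *\<^sub>R y \<in> W" if "y \<in> W" for y c
    using lin_W[OF zero_W that] by simp
  \<comment> \<open>The unit sphere of \<open>W\<close> is nonempty: a vector outside the kernel has
    a nonzero Gram image, which lies in \<open>W\<close> and can be normalised.\<close>
  obtain y where "A *v y \<noteq> 0" using assms by (metis matrix_eq matrix_vector_mult_0)
  then have "((transpose A ** A) *v y) \<bullet> y \<noteq> 0" unfolding inner_gram by simp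
  then have "(transpose A ** A) *v y \<noteq> 0" by auto
  then have "sgn ((transpose A ** A) *v y) \<in> W \<inter> sphere 0 1"
    using scale_W[OF gram_W] by (simp add: sgn_div_norm norm_sgn)
  moreover have "closed W"
  proof -
    have "W = (\<Inter>w\<in>{w. A *v w = 0}. {u. u \<bullet> w = 0})" by (auto simp: W_def)
    moreover have "closed {u. u \<bullet> w = 0}" for w :: "real^'n"
      by (intro closed_Collect_eq continuous_intros)
    ultimately show ?thesis by auto
  qed
  then have "compact (W \<inter> sphere 0 1)" by (intro closed_Int_compact compact_sphere)
  moreover have "continuous_on (W \<inter> sphere 0 1) (\<lambda>u. norm (A *v u))"
    by (intro continuous_intros linear_continuous_on matrix_vector_mul_bounded_linear)
  ultimately obtain u0 where "u0 \<in> W \<inter> sphere 0 1"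
    "\<forall>u\<in>W \<inter> sphere 0 1. norm (A *v u0) \<le> norm (A *v u)"
    using continuous_attains_inf[of "W \<inter> sphere 0 1" "\<lambda>u. norm (A *v u)"] by blast
  then have u0: "u0 \<in> W" "norm u0 = 1"
    and min: "\<And>u. u \<in> W \<Longrightarrow> norm u = 1 \<Longrightarrow> norm (A *v u0) \<le> norm (A *v u)"
    by auto
  have min': "norm (A *v u0) * norm u \<le> norm (A *v u)" if "u \<in> W" for u
  proof (cases "u = 0")
    case False
    have "norm (A *v u0) \<le> norm (A *v sgn u)"
      using scale_W[OF that] False by (intro min) (auto simp: sgn_div_norm)
    then show ?thesis using False by (simp add: sgn_div_norm matrix_vector_mult_scaleR field_simps)
  qed simp
  define l where "l = (norm (A *v u0))\<^sup>2"
  define q where "q u = (A *v u) \<bullet> (A *v u) - l * (u \<bullet> u)" for u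
  have q_nonneg: "0 \<le> q u" if "u \<in> W" for u
    using power_mono[OF min'[OF that], of 2]
    by (simp add: q_def l_def power_mult_distrib power2_norm_eq_inner)
  have q_u0: "q u0 = 0"
    using u0(2) by (simp add: q_def l_def power2_norm_eq_inner norm_eq_1)
  define r where "r = (transpose A ** A) *v u0 - l *\<^sub>R u0"
  have r_W: "r \<in> W" using lin_W[OF gram_W u0(1), of u0 "- l"] by (simp add: r_def)
  text \<open>The form \<open>q\<close> is nonnegative on \<open>W\<close> and vanishes at \<open>u0\<close>, so its derivative there,
    in particular in direction \<open>r\<close>, is zero.\<close>
  have expand: "q (u0 + s *\<^sub>R r) = 2 * s * (r \<bullet> r) + s\<^sup>2 * q r" for s
  proof -
    have "r \<bullet> r = ((transpose A ** A) *v u0 - l *\<^sub>R u0) \<bullet> r" by (simp only: r_def)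
    also have "\<dots> = (A *v u0) \<bullet> (A *v r) - l * (u0 \<bullet> r)"
      unfolding inner_gram[symmetric] by (simp add: inner_diff_left)
    finally have "r \<bullet> r = (A *v u0) \<bullet> (A *v r) - l * (u0 \<bullet> r)" .
    moreover have "q (u0 + s *\<^sub>R r) = q u0 + 2 * s * ((A *v u0) \<bullet> (A *v r) - l * (u0 \<bullet> r)) + s\<^sup>2 * q r"
      unfolding q_def
      by (simp add: matrix_vector_right_distrib matrix_vector_mult_scaleR inner_add_left inner_add_right
          inner_commute power2_eq_square algebra_simps)
    ultimately show ?thesis using q_u0 by simp
  qed
  have "r = 0"
  proof (rule ccontr)
    assume "r \<noteq> 0"
    then have c: "r \<bullet> r > 0" by simp
    \<comment> \<open>The added 1 makes \<open>Q\<close> positive even if \<open>q r = 0\<close>.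
      The step \<open>s\<close> solves \<open>s * Q = - (r \<bullet> r)\<close>, which turns the
      expansion into \<open>s * (r \<bullet> r) - s^2 < 0\<close>.\<close>
    define Q where "Q = q r + 1"
    have Q: "Q > 0" using q_nonneg[OF r_W] by (simp add: Q_def)
    define s where "s = - (r \<bullet> r) / Q"
    have sQ: "s * Q = - (r \<bullet> r)" using Q by (simp add: s_def)
    have "s < 0" using c Q by (simp add: s_def)
    have "q (u0 + s *\<^sub>R r) = 2 * s * (r \<bullet> r) + s * (s * Q) - s\<^sup>2"
      unfolding expand by (simp add: Q_def power2_eq_square algebra_simps)
    also have "\<dots> = s * (r \<bullet> r) - s\<^sup>2" unfolding sQ by simp
    also have "\<dots> < 0" using mult_neg_pos[OF \<open>s < 0\<close> c] zero_le_power2[of s] by linarith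
    finally show False using q_nonneg[OF lin_W[OF u0(1) r_W], of s] by simp
  qed
  have "A *v u0 \<noteq> 0"
  proof
    assume "A *v u0 = 0"
    then have "u0 \<bullet> u0 = 0" using u0(1) unfolding W_def by blast
    then show False using u0(2) by simp
  qed
  have "sqrt l \<in> singular_values A"
    unfolding singular_values_def using \<open>r = 0\<close> u0(2) by (auto simp: r_def intro!: exI[of _ l] exI[of _ u0])
  then have mem: "norm (A *v u0) \<in> singular_values A - {0}"
    using \<open>A *v u0 \<noteq> 0\<close> by (simp add: l_def)
  have fin: "finite (singular_values A - {0})" using finite_singular_values by simp
  then have "sigma_min_pos A \<in> singular_values A - {0}"
    unfolding sigma_min_pos_def using mem by (intro Min_in) auto
  then show "sigma_min_pos A > 0" using singular_value_nonneg[of "sigma_min_pos A" A] by force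
  assume "\<And>w. A *v w = 0 \<Longrightarrow> u \<bullet> w = 0"
  then have "u \<in> W" by (simp add: W_def)
  have "sigma_min_pos A * norm u \<le> norm (A *v u0) * norm u"
    unfolding sigma_min_pos_def using Min_le[OF fin mem] by (intro mult_right_mono) auto
  then show "sigma_min_pos A * norm u \<le> norm (A *v u)" using min'[OF \<open>u \<in> W\<close>] by linarith
qed

section \<open>Distance to the feasible set\<close>

lemma closed_feasible: "closed (feasible A b)" for A :: "real^'n^'r"
  unfolding feasible_def
  by (intro closed_Collect_eq continuous_intros linear_continuous_on matrix_vector_mul_bounded_linear)

lemma convex_feasible: "convex (feasible A b)" for A :: "real^'n^'r"
proof (rule convexI)
  fix x y :: "real^'n" and u v :: real
  assume "x \<in> feasible A b" "y \<in> feasible A b" "u + v = 1"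
  then show "u *\<^sub>R x + v *\<^sub>R y \<in> feasible A b"
    by (simp add: feasible_def matrix_vector_right_distrib matrix_vector_mult_scaleR scaleR_left_distrib[symmetric])
qed

lemma feasible_error_bound:
  fixes A :: "real^'n^'r"
  assumes "A \<noteq> 0" and "feasible A b \<noteq> {}"
  obtains z where "z \<in> feasible A b" "norm (x - z) \<le> norm (A *v x - b) / sigma_min_pos A"
proof -
  obtain z where z: "z \<in> feasible A b" and dist: "\<And>y. y \<in> feasible A b \<Longrightarrow> dist x z \<le> dist x y"
    using distance_attains_inf[OF closed_feasible assms(2)] by blast
  have le: "(x - z) \<bullet> w \<le> 0" if "A *v w = 0" for w
  proof -
    have "z + w \<in> feasible A b" using z that by (simp add: feasible_def matrix_vector_right_distrib)
    then show ?thesis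
      using any_closest_point_dot[OF convex_feasible closed_feasible z, of "z + w" x] dist by simp
  qed
  \<comment> \<open>With \<open>w\<close> also \<open>- w\<close> lies in the kernel, so the
    projection inequality becomes orthogonality, as the singular value estimate requires.\<close>
  have "(x - z) \<bullet> w = 0" if "A *v w = 0" for w
    using le[OF that] le[of "- w"] that matrix_vector_mult_diff_distrib[of A 0 w] by simp
  then have "sigma_min_pos A * norm (x - z) \<le> norm (A *v (x - z))"
    by (rule sigma_min_pos(2)[OF assms(1)])
  also have "A *v (x - z) = A *v x - b" using z by (simp add: feasible_def matrix_vector_mult_diff_distrib)
  finally have "norm (x - z) \<le> norm (A *v x - b) / sigma_min_pos A"
    using sigma_min_pos(1)[OF assms(1)] by (simp add: field_simps)
  with z show thesis by (rule that)
qed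

section \<open>Lyapunov decay along a trajectory\<close>

lemma Min_range_affine:
  fixes g :: "'m::finite \<Rightarrow> real"
  assumes "0 \<le> c"
  shows "(MIN j. c * (g j + r)) = c * ((MIN j. g j) + r)"
proof -
  have "mono (\<lambda>y. c * (y + r))" using assms by (intro monoI mult_left_mono add_right_mono)
  then have "c * (Min (range g) + r) = Min ((\<lambda>y. c * (y + r)) ` range g)"
    by (rule mono_Min_commute) auto
  then show ?thesis by (simp add: image_image)
qed

lemma norm_diff_squared_le: "(a - b) \<bullet> (a - b) \<le> 2 * ((norm a)\<^sup>2 + (norm b)\<^sup>2)"
  for a b :: "'a::real_inner"
proof -
  have "0 \<le> (a + b) \<bullet> (a + b)" by simp
  then show ?thesis
    unfolding power2_norm_eq_inner by (simp add: inner_add_left inner_add_right inner_diff_left inner_diff_right inner_commute)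
qed

lemma has_real_derivative_nonneg_le:
  fixes h :: "real \<Rightarrow> real"
  assumes "\<And>t. t \<ge> 0 \<Longrightarrow> (h has_real_derivative h' t) (at t within {0..})"
    and "\<And>t. t \<ge> 0 \<Longrightarrow> h' t \<ge> 0" and "t \<ge> 0"
  shows "h 0 \<le> h t"
proof -
  have "(h has_derivative (\<lambda>y. h' s * y)) (at s within {0..t})" if "0 \<le> s" "s \<le> t" for s
    using DERIV_subset[OF assms(1)[OF that(1)], of "{0..t}"] by (auto simp: has_field_derivative_def)
  from mvt_very_simple[OF assms(3) this] obtain s where "s \<in> {0..t}" "h t - h 0 = h' s * (t - 0)"
    by auto
  moreover have "0 \<le> h' s * (t - 0)" using \<open>s \<in> {0..t}\<close> assms(2)[of s] assms(3) by simp
  ultimately show ?thesis by simp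
qed

locale ampd_trajectory = smooth_convex_objectives f \<mu>f Lf \<mu> L
  for f :: "'m::finite \<Rightarrow> real^'n \<Rightarrow> real" and \<mu>f Lf \<mu> L +
  fixes A :: "real^'n^'r" and b :: "real^'r" and \<theta>0 \<gamma>0 :: real and \<theta> \<gamma> :: "real \<Rightarrow> real"
    and x0 v0 :: "real^'n" and \<xi>0 :: "real^'r"
    and x v :: "real \<Rightarrow> real^'n" and \<xi> :: "real \<Rightarrow> real^'r"
  assumes theta_pos: "\<theta>0 > 0" and gamma_pos: "\<gamma>0 > 0"
    and theta_ode: "\<And>t. t \<ge> 0 \<Longrightarrow> (\<theta> has_real_derivative - \<theta> t) (at t within {0..})"
    and theta_init: "\<theta> 0 = \<theta>0"
    and gamma_ode: "\<And>t. t \<ge> 0 \<Longrightarrow> (\<gamma> has_real_derivative \<mu> - \<gamma> t) (at t within {0..})"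
    and gamma_init: "\<gamma> 0 = \<gamma>0"
    and solution: "ampd_di_solution f \<mu> A b \<theta> \<gamma> x0 v0 \<xi>0 x v \<xi>"
begin

abbreviation K0 where "K0 \<equiv> C0 f L A b \<theta>0 \<gamma>0 x0 v0 \<xi>0"

lemma initial: "x 0 = x0" "v 0 = v0" "\<xi> 0 = \<xi>0"
  and v_AC: "T \<ge> 0 \<Longrightarrow> abs_continuous_on {0..T} v"
  and xi_C1: "c1_on {0..} \<xi>"
  and x_ode: "t \<ge> 0 \<Longrightarrow> (x has_vector_derivative (v t - x t)) (at t within {0..})"
  and xi_ode: "t \<ge> 0 \<Longrightarrow> \<exists>d. (\<xi> has_vector_derivative d) (at t within {0..}) \<and> \<theta> t *\<^sub>R d = A *v v t - b"
  and v_AE: "AE t in lebesgue_on {0..}. \<exists>d. (v has_vector_derivative d) (at t within {0..}) \<and>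
        \<gamma> t *\<^sub>R d \<in> (\<lambda>z. \<mu> *\<^sub>R (x t - v t) - transpose A *v \<xi> t - z) `
          argmin_on (grad_hull f (x t)) (\<lambda>z. (x t - v t) \<bullet> z)"
  using solution unfolding ampd_di_solution_def by auto

text \<open>With the integrating factor \<open>exp\<close>, the product
  \<open>\<theta> t * exp t\<close> has derivative zero.\<close>

lemma theta_nonneg: assumes "t \<ge> 0" shows "\<theta> t \<ge> 0"
proof -
  have "\<theta> 0 * exp 0 \<le> \<theta> t * exp t"
  proof (rule has_real_derivative_nonneg_le[OF _ _ assms])
    show "((\<lambda>t. \<theta> t * exp t) has_real_derivative 0) (at t within {0..})" if "t \<ge> 0" for t
      by (rule derivative_eq_intros theta_ode that refl)+ simp
  qed simp
  then have "0 \<le> \<theta> t * exp t" using theta_pos theta_init by simp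
  then show ?thesis by (simp add: zero_le_mult_iff not_le[symmetric])
qed

lemma gamma_nonneg: assumes "t \<ge> 0" shows "\<gamma> t \<ge> 0"
proof -
  have "\<gamma> 0 * exp 0 \<le> \<gamma> t * exp t"
  proof (rule has_real_derivative_nonneg_le[OF _ _ assms])
    show "((\<lambda>t. \<gamma> t * exp t) has_real_derivative (\<mu> * exp t)) (at t within {0..})" if "t \<ge> 0" for t
      by (rule derivative_eq_intros gamma_ode that refl)+ (simp add: algebra_simps)
  qed (use mu_nonneg in simp)
  then have "0 \<le> \<gamma> t * exp t" using gamma_pos gamma_init by simp
  then show ?thesis by (simp add: zero_le_mult_iff not_le[symmetric])
qed

text \<open>The part of the Lyapunov function that does not depend on the index \<open>j\<close>, so
  it moves freely in and out of the minimum.\<close>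

definition rest :: "real^'r \<Rightarrow> real^'n \<Rightarrow> real \<Rightarrow> real" where
  "rest \<eta> z t = \<eta> \<bullet> (A *v x t - b) + \<gamma> t / 2 * ((v t - z) \<bullet> (v t - z))
     + \<theta> t / 2 * ((\<xi> t - \<eta>) \<bullet> (\<xi> t - \<eta>))"

lemma continuous_v: "continuous_on {0..T} v"
proof (cases "T \<ge> 0")
  case True
  then show ?thesis by (intro abs_continuous_on_imp_continuous_on v_AC)
qed simp

lemma x_deriv: "t \<in> {0..T} \<Longrightarrow> (x has_vector_derivative (v t - x t)) (at t within {0..T})"
  by (rule has_vector_derivative_within_subset[OF x_ode]) auto

lemma continuous_x: "continuous_on {0..T} x"
  unfolding continuous_on_eq_continuous_within using has_vector_derivative_continuous[OF x_deriv] by simp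

lemma dominated_v: "dominated_by v {0..T} v"
  by (intro dominated_by_self compact_imp_bounded compact_continuous_image continuous_v compact_Icc)

lemma dominated_xi: "dominated_by v {0..T} \<xi>"
proof -
  obtain \<xi>' where \<xi>': "\<forall>t\<in>{0..}. (\<xi> has_vector_derivative \<xi>' t) (at t within {0..})" "continuous_on {0..} \<xi>'"
    using xi_C1 unfolding c1_on_def by blast
  show ?thesis
  proof (rule dominated_by_C1)
    show "(\<xi> has_vector_derivative \<xi>' t) (at t within {0..T})" if "t \<in> {0..T}" for t
      by (rule has_vector_derivative_within_subset[OF \<xi>'(1)[rule_format]]) (use that in auto)
    show "continuous_on {0..T} \<xi>'" by (rule continuous_on_subset[OF \<xi>'(2)]) auto
  qed
qed

lemma theta_deriv: "t \<in> {0..T} \<Longrightarrow> (\<theta> has_real_derivative - \<theta> t) (at t within {0..T})"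
  and gamma_deriv: "t \<in> {0..T} \<Longrightarrow> (\<gamma> has_real_derivative \<mu> - \<gamma> t) (at t within {0..T})"
  by (rule DERIV_subset[OF theta_ode] DERIV_subset[OF gamma_ode]; auto)+

lemma dominated_theta: "dominated_by v {0..T} \<theta>"
  and dominated_gamma: "dominated_by v {0..T} \<gamma>"
proof -
  have "continuous_on {0..T} \<theta>" "continuous_on {0..T} \<gamma>"
    unfolding continuous_on_eq_continuous_within
    using DERIV_continuous[OF theta_deriv] DERIV_continuous[OF gamma_deriv] by simp_all
  then show "dominated_by v {0..T} \<theta>" "dominated_by v {0..T} \<gamma>"
    by (intro dominated_by_C1[OF theta_deriv[unfolded has_real_derivative_iff_has_vector_derivative]]
        dominated_by_C1[OF gamma_deriv[unfolded has_real_derivative_iff_has_vector_derivative]]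
        continuous_intros; simp)+
qed

lemma objective_deriv:
  "t \<in> {0..T} \<Longrightarrow> ((\<lambda>t. f j (x t)) has_real_derivative grad (f j) (x t) \<bullet> (v t - x t)) (at t within {0..T})"
  by (rule GDERIV_chain_within[OF gderiv_grad x_deriv])

lemma dominated_objective: "dominated_by v {0..T} (\<lambda>t. f j (x t))"
  by (rule dominated_by_C1[OF objective_deriv[unfolded has_real_derivative_iff_has_vector_derivative]])
    (auto intro!: continuous_intros continuous_v continuous_x continuous_on_compose2[OF continuous_grad[of UNIV] continuous_x])

lemma constraint_deriv:
  "t \<in> {0..T} \<Longrightarrow> ((\<lambda>t. \<eta> \<bullet> (A *v x t - b)) has_real_derivative \<eta> \<bullet> (A *v (v t - x t))) (at t within {0..T})"
proof -
  assume "t \<in> {0..T}"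
  have "((\<lambda>t. A *v x t) has_vector_derivative A *v (v t - x t)) (at t within {0..T})"
    by (rule bounded_linear.has_vector_derivative[OF matrix_vector_mul_bounded_linear x_deriv]) fact
  then have "((\<lambda>t. A *v x t - b) has_vector_derivative A *v (v t - x t) - 0) (at t within {0..T})"
    by (intro has_vector_derivative_diff has_vector_derivative_const)
  from has_real_derivative_inner[OF has_vector_derivative_const this, of \<eta>]
  show ?thesis by simp
qed

lemma dominated_constraint: "dominated_by v {0..T} (\<lambda>t. \<eta> \<bullet> (A *v x t - b))"
  by (rule dominated_by_C1[OF constraint_deriv[unfolded has_real_derivative_iff_has_vector_derivative]])
    (auto intro!: continuous_intros continuous_v continuous_x
      bounded_linear.continuous_on[OF matrix_vector_mul_bounded_linear])

lemma dominated_lyapunov: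
  "dominated_by v {0..T} (\<lambda>t. exp t * ((f j (x t) - c) + rest \<eta> z t))"
proof -
  have exp: "dominated_by v {0..T} exp"
    by (rule dominated_by_C1[where u' = exp])
      (auto intro!: continuous_intros derivative_eq_intros simp: has_real_derivative_iff_has_vector_derivative[symmetric])
  \<comment> \<open>Differences appear as sums with negated constants, and halves as constant
    factors, to match the closure rules for sums, products and constants.\<close>
  have sq: "dominated_by v {0..T} (\<lambda>t. (1 / 2) * s t * ((y t + - w) \<bullet> (y t + - w)))"
    if "dominated_by v {0..T} s" "dominated_by v {0..T} y" for s :: "real \<Rightarrow> real" and y :: "real \<Rightarrow> real^'k" and w
    by (intro dominated_by_mult dominated_by_inner dominated_by_add dominated_by_const that)
  have "dominated_by v {0..T} (\<lambda>t. exp t * ((f j (x t) + - c) + ((\<eta> \<bullet> (A *v x t - b)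
     + (1 / 2) * \<gamma> t * ((v t + - z) \<bullet> (v t + - z))) + (1 / 2) * \<theta> t * ((\<xi> t + - \<eta>) \<bullet> (\<xi> t + - \<eta>)))))"
    by (intro dominated_by_mult[OF exp] dominated_by_add dominated_constraint dominated_objective
        dominated_by_const sq dominated_v dominated_xi dominated_theta dominated_gamma)
  then show ?thesis by (simp add: rest_def)
qed

lemma lyapunov_decreasing:
  assumes z: "A *v z = b" and T: "T \<ge> 0"
  shows "exp T * ((MIN j. f j (x T) - f j z) + rest \<eta> z T) \<le> (MIN j. f j x0 - f j z) + rest \<eta> z 0"
proof -
  define P where "P t \<longleftrightarrow> (\<exists>d. (v has_vector_derivative d) (at t within {0..}) \<and>
        \<gamma> t *\<^sub>R d \<in> (\<lambda>z. \<mu> *\<^sub>R (x t - v t) - transpose A *v \<xi> t - z) `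
          argmin_on (grad_hull f (x t)) (\<lambda>z. (x t - v t) \<bullet> z))" for t
  have "AE t in lebesgue. t \<in> {0..} \<longrightarrow> P t"
    using v_AE unfolding P_def[symmetric] by (subst (asm) AE_restrict_space_iff) auto
  then obtain N where N: "N \<in> null_sets lebesgue" "{t. \<not> (t \<in> {0..} \<longrightarrow> P t)} \<subseteq> N"
    unfolding eventually_ae_filter by auto
  have "\<forall>t\<in>{0..T} - N. P t" using N(2) by auto
  then have "\<forall>t\<in>{0..T} - N. \<exists>d g. (v has_vector_derivative d) (at t within {0..}) \<and>
     g \<in> argmin_on (grad_hull f (x t)) (\<lambda>z. (x t - v t) \<bullet> z) \<and>
     \<gamma> t *\<^sub>R d = \<mu> *\<^sub>R (x t - v t) - transpose A *v \<xi> t - g"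
    unfolding P_def image_iff by blast
  then obtain v' g where v'_ode: "\<And>t. t \<in> {0..T} - N \<Longrightarrow> (v has_vector_derivative v' t) (at t within {0..})"
    and g: "\<And>t. t \<in> {0..T} - N \<Longrightarrow> g t \<in> argmin_on (grad_hull f (x t)) (\<lambda>z. (x t - v t) \<bullet> z)"
    and v'_eq: "\<And>t. t \<in> {0..T} - N \<Longrightarrow> \<gamma> t *\<^sub>R v' t = \<mu> *\<^sub>R (x t - v t) - transpose A *v \<xi> t - g t"
    by metis
  obtain \<xi>' where \<xi>'_ode: "\<And>t. t \<ge> 0 \<Longrightarrow> (\<xi> has_vector_derivative \<xi>' t) (at t within {0..})"
    and \<xi>'_eq: "\<And>t. t \<ge> 0 \<Longrightarrow> \<theta> t *\<^sub>R \<xi>' t = A *v v t - b"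
    using xi_ode by metis
  define a where "a j t = exp t * ((f j (x t) - f j z) + rest \<eta> z t)" for j t
  define rest' where "rest' t = \<eta> \<bullet> (A *v (v t - x t)) + (\<mu> - \<gamma> t) / 2 * ((v t - z) \<bullet> (v t - z))
    + \<gamma> t * ((v t - z) \<bullet> v' t) - \<theta> t / 2 * ((\<xi> t - \<eta>) \<bullet> (\<xi> t - \<eta>)) + \<theta> t * ((\<xi> t - \<eta>) \<bullet> \<xi>' t)" for t
  \<comment> \<open>The first summand comes from differentiating \<open>exp\<close>, so
    \<open>D j t \<le> 0\<close> says that energy plus its derivative is nonpositive at index
    \<open>j\<close>. In \<open>rest'\<close> the derivatives of \<gamma> and \<theta> are already
    replaced by their equations.\<close>
  define D where "D j t = exp t * (((f j (x t) - f j z) + rest \<eta> z t)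
    + (grad (f j) (x t) \<bullet> (v t - x t) + rest' t))" for j t
  have Min_a: "(MIN j. a j t) = exp t * ((MIN j. f j (x t) - f j z) + rest \<eta> z t)" for t
    unfolding a_def by (rule Min_range_affine) simp
  have "(MIN j. a j T) \<le> (MIN j. a j 0)"
  proof (rule Min_AC_decreasing[where a = a and D = D, OF T v_AC[OF T]])
    show "negligible N" using N(1) by (simp add: negligible_iff_null_sets)
    show "dominated_by v {0..T} (a j)" for j
      unfolding a_def by (rule dominated_lyapunov)
    show "(a j has_real_derivative D j t) (at t within {0..T})" if t: "t \<in> {0..T} - N" for t j
    proof -
      have t': "t \<in> {0..T}" using t by simp
      have vd: "((\<lambda>t. v t - z) has_vector_derivative v' t - 0) (at t within {0..T})"
        by (intro has_vector_derivative_diff has_vector_derivative_const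
            has_vector_derivative_within_subset[OF v'_ode[OF t]]) auto
      have xd: "((\<lambda>t. \<xi> t - \<eta>) has_vector_derivative \<xi>' t - 0) (at t within {0..T})"
        by (intro has_vector_derivative_diff has_vector_derivative_const
            has_vector_derivative_within_subset[OF \<xi>'_ode]) (use t in auto)
      have r: "(rest \<eta> z has_real_derivative rest' t) (at t within {0..T})"
        unfolding rest_def[abs_def]
        by (rule DERIV_cong[OF DERIV_add[OF DERIV_add[OF constraint_deriv[OF t']
              DERIV_mult[OF DERIV_cdivide[OF gamma_deriv[OF t']] has_real_derivative_inner[OF vd vd]]]
              DERIV_mult[OF DERIV_cdivide[OF theta_deriv[OF t']] has_real_derivative_inner[OF xd xd]]]])
          (simp add: rest'_def inner_commute algebra_simps)
      have o: "((\<lambda>t. f j (x t) - f j z) has_real_derivative grad (f j) (x t) \<bullet> (v t - x t) - 0) (at t within {0..T})"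
        by (intro DERIV_diff objective_deriv t' DERIV_const)
      show ?thesis
        unfolding a_def[abs_def]
        by (rule DERIV_cong[OF DERIV_mult[OF has_field_derivative_at_within[OF DERIV_exp] DERIV_add[OF o r]]])
          (simp add: D_def algebra_simps)
    qed
    show "D j t \<le> 0" if t: "t \<in> {0..T} - N" and active: "a j t = (MIN i. a i t)" for t j
    proof -
      \<comment> \<open>At an active index the objective difference equals the minimum
        \<open>m\<close>, and \<open>m\<close> is a lower bound for all indices, as the hull
        estimate demands.\<close>
      define m where "m = (MIN j. f j (x t) - f j z)"
      have m: "f j (x t) - f j z = m"
        using active[unfolded Min_a] unfolding a_def m_def by simp
      have min: "g t \<in> grad_hull f (x t)"
        "\<And>y. y \<in> grad_hull f (x t) \<Longrightarrow> (x t - v t) \<bullet> g t \<le> (x t - v t) \<bullet> y"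
        using g[OF t] by (auto simp: argmin_on_def is_arg_min_linorder)
      have "(f j (x t) - f j z + rest \<eta> z t) + (grad (f j) (x t) \<bullet> (v t - x t) + rest' t) \<le> 0"
        unfolding m rest_def rest'_def
      proof (rule lyapunov_dissipation[OF z _ v'_eq[OF t] _ _ mu_nonneg])
        show "\<theta> t *\<^sub>R \<xi>' t = A *v v t - b" using t by (intro \<xi>'_eq) simp
        \<comment> \<open>Minimising the product with \<open>x t - v t\<close> means maximising the
          one with \<open>v t - x t\<close>, and each gradient competes as a member of the
          hull.\<close>
        show "grad (f j) (x t) \<bullet> (v t - x t) \<le> g t \<bullet> (v t - x t)"
          using min(2)[OF grad_in_hull, of j] by (simp add: inner_diff_left inner_diff_right inner_commute)
        show "g t \<bullet> (z - x t) \<le> - m - \<mu> / 2 * (norm (x t - z))\<^sup>2"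
          unfolding m_def by (rule hull_inner_le[OF min(1) Min_range_le])
      qed
      then show ?thesis unfolding D_def by (simp add: mult_le_0_iff)
    qed
  qed
  then show ?thesis unfolding Min_a by (simp add: initial)
qed

lemma initial_energy_le:
  "(MIN j. f j x0 - f j z) + rest \<eta> z 0 \<le> K0 (norm z) (norm \<eta>)"
proof -
  let ?s = "norm z"
  have "(MIN j. f j x0 - f j z) \<le> (G + L * norm x0) * (norm x0 + ?s)"
    using order_trans[OF Min_range_le objective_diff_le] .
  \<comment> \<open>The added term exchanges \<open>L * norm x0\<close> for
    \<open>L * norm z\<close> in the first factor, which gives the shape of
    \<open>C0\<close>.\<close>
  also have "\<dots> \<le> (G + L * norm x0) * (norm x0 + ?s) + 2 * (L * ?s\<^sup>2)" using L_nonneg by simp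
  also have "\<dots> = (G + L * ?s) * (norm x0 + ?s) + L * ((norm x0)\<^sup>2 + ?s\<^sup>2)"
    by (simp add: algebra_simps power2_eq_square)
  finally have 1: "(MIN j. f j x0 - f j z) \<le> (G + L * ?s) * (norm x0 + ?s) + L * ((norm x0)\<^sup>2 + ?s\<^sup>2)" .
  have 2: "\<eta> \<bullet> (A *v x0 - b) \<le> norm \<eta> * norm (A *v x0 - b)" by (rule norm_cauchy_schwarz)
  have 3: "\<gamma>0 / 2 * ((v0 - z) \<bullet> (v0 - z)) \<le> \<gamma>0 * ((norm v0)\<^sup>2 + ?s\<^sup>2)"
    using mult_left_mono[OF norm_diff_squared_le[of v0 z], of "\<gamma>0 / 2"] gamma_pos by simp
  have 4: "\<theta>0 / 2 * ((\<xi>0 - \<eta>) \<bullet> (\<xi>0 - \<eta>)) \<le> \<theta>0 * ((norm \<xi>0)\<^sup>2 + (norm \<eta>)\<^sup>2)"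
    using mult_left_mono[OF norm_diff_squared_le[of \<xi>0 \<eta>], of "\<theta>0 / 2"] theta_pos by simp
  show ?thesis
    using 1 2 3 4 unfolding C0_def rest_def initial theta_init gamma_init by linarith
qed

text \<open>The two squared terms of the energy are nonnegative and dropped. As the bound at a given
  time holds for every feasible \<open>z\<close> and every \<eta>, both may be chosen afterwards in
  dependence on \<open>x t\<close>.\<close>

lemma decay:
  assumes "A *v z = b" "t \<ge> 0"
  shows "(MIN j. f j (x t) - f j z) + \<eta> \<bullet> (A *v x t - b) \<le> K0 (norm z) (norm \<eta>) * exp (- t)"
proof -
  have "(MIN j. f j (x t) - f j z) + \<eta> \<bullet> (A *v x t - b) \<le> (MIN j. f j (x t) - f j z) + rest \<eta> z t"
    using theta_nonneg[OF assms(2)] gamma_nonneg[OF assms(2)] by (simp add: rest_def)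
  also have "\<dots> \<le> K0 (norm z) (norm \<eta>) * exp (- t)"
    using order_trans[OF lyapunov_decreasing[OF assms, of \<eta>] initial_energy_le[of z \<eta>]]
    by (simp add: exp_minus field_simps)
  finally show ?thesis .
qed

lemma K0_mono:
  assumes "0 \<le> s" "s \<le> s'" "0 \<le> t" "t \<le> t'"
  shows "K0 s t \<le> K0 s' t'"
  unfolding C0_def using assms L_nonneg G_nonneg theta_pos gamma_pos
  by (intro add_mono mult_mono power_mono order_refl) simp_all

lemma K0_nonneg: "0 \<le> s \<Longrightarrow> 0 \<le> t \<Longrightarrow> 0 \<le> K0 s t"
  unfolding C0_def using L_nonneg G_nonneg theta_pos gamma_pos by simp

end

section \<open>The gap bound\<close>

lemma norm_le_level_radius:
  assumes bounded: "\<And>j. bounded (level_set (f j) a)" and le: "f j y \<le> a"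
  shows "norm y \<le> level_radius f a"
proof -
  have "bdd_above (norm ` level_set (f j) a)"
    using bounded[of j] by (simp add: bdd_above_norm)
  then have "norm y \<le> (SUP x\<in>level_set (f j) a. norm x)"
    by (rule cSUP_upper2) (use le in \<open>auto simp: level_set_def\<close>)
  also have "\<dots> \<le> level_radius f a" unfolding level_radius_def by (rule Max_ge) auto
  finally show ?thesis .
qed

lemma mem_vlevel_set: "y \<in> vlevel_set f a \<longleftrightarrow> (\<forall>j. f j y \<le> a $ j)"
  by (simp add: vlevel_set_def objective_def less_eq_vec_def)

text \<open>The fibre of \<open>objective f\<close> in \<Omega> is closed, so its infimum of norms
  is attained, at \<open>w\<close>. The supremum bounds that infimum because its range is bounded
  above.\<close>

lemma pareto_radius_attained:
  fixes f :: "'m::finite \<Rightarrow> real^'n \<Rightarrow> real"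
  assumes bounded: "\<And>j a. bounded (level_set (f j) a)"
    and cont: "\<And>j. continuous_on UNIV (f j)" and closed: "closed \<Omega>"
    and y: "y \<in> weak_pareto f \<Omega> \<inter> vlevel_set f a"
  obtains w where "w \<in> \<Omega>" "objective f w = objective f y" "norm w \<le> pareto_radius f \<Omega> a"
proof -
  define S where "S y = objective f -` {objective f y} \<inter> \<Omega>" for y
  have "closed {w. objective f w = objective f y}"
    unfolding objective_def by (intro closed_Collect_eq continuous_on_vec_lambda cont continuous_intros)
  moreover have "S y = {w. objective f w = objective f y} \<inter> \<Omega>" by (auto simp: S_def)
  ultimately have "closed (S y)" using closed by auto
  moreover have "y \<in> S y" using y by (simp add: S_def weak_pareto_def)
  ultimately obtain w where w: "w \<in> S y" "\<And>u. u \<in> S y \<Longrightarrow> norm w \<le> norm u"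
    using distance_attains_inf[of "S y" 0] by auto
  have Inf_w: "(INF u\<in>S y. norm u) = norm w"
    by (rule cInf_eq_minimum) (use w in auto)
  \<comment> \<open>One arbitrary index suffices: its bounded level set contains every
    \<open>u\<close> considered, and \<open>u\<close> itself competes in the inner infimum.\<close>
  obtain B where B: "\<And>u. u \<in> level_set (f undefined) (a $ undefined) \<Longrightarrow> norm u \<le> B"
    using bounded[of undefined "a $ undefined"] unfolding bounded_iff by blast
  have "bdd_above ((\<lambda>Fs. INF u\<in>objective f -` {Fs} \<inter> \<Omega>. norm u) `
      objective f ` (weak_pareto f \<Omega> \<inter> vlevel_set f a))"
  proof (rule bdd_aboveI2, clarify)
    fix u assume u: "u \<in> weak_pareto f \<Omega>" "u \<in> vlevel_set f a"
    have "(INF u'\<in>objective f -` {objective f u} \<inter> \<Omega>. norm u') \<le> norm u"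
      by (rule cINF_lower) (use u in \<open>auto simp: weak_pareto_def intro!: bdd_belowI2[where m = 0]\<close>)
    also have "\<dots> \<le> B" using u(2) by (intro B) (simp add: mem_vlevel_set level_set_def)
    finally show "(INF u'\<in>objective f -` {objective f u} \<inter> \<Omega>. norm u') \<le> B" .
  qed
  then have "norm w \<le> pareto_radius f \<Omega> a"
    unfolding pareto_radius_def Inf_w[symmetric] S_def by (rule cSUP_upper[rotated]) (use y in blast)
  moreover have "w \<in> \<Omega>" "objective f w = objective f y" using w(1) by (auto simp: S_def)
  ultimately show thesis using that by blast
qed

section \<open>Upper and lower estimates of the gap\<close>

locale ampd_pareto = ampd_trajectory f \<mu>f Lf \<mu> L A b \<theta>0 \<gamma>0 \<theta> \<gamma> x0 v0 \<xi>0 x v \<xi>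
  for f :: "'m::finite \<Rightarrow> real^'n \<Rightarrow> real" and \<mu>f Lf \<mu> L and A :: "real^'n^'r" and b \<theta>0 \<gamma>0 \<theta> \<gamma> x0 v0 \<xi>0 x v \<xi> +
  fixes \<alpha>s :: "real^'m" and xbar :: "real^'n"
  assumes A_nonzero: "A \<noteq> 0"
    and level_bounded: "\<And>j a. bounded (level_set (f j) a)"
    and pareto: "\<And>a y. y \<in> vlevel_set f a \<inter> feasible A b \<Longrightarrow>
      \<exists>ys. ys \<in> weak_pareto f (feasible A b) \<inter> vlevel_set f (objective f y)"
    and xbar: "xbar \<in> feasible A b"
begin

abbreviation a0 where "a0 \<equiv> alpha0 f L A b \<theta>0 \<gamma>0 x0 v0 \<xi>0 xbar"
abbreviation a1 where "a1 \<equiv> alpha1 f L A b \<theta>0 \<gamma>0 x0 v0 \<xi>0 xbar"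
abbreviation a2 where "a2 \<equiv> alpha2 f L A b \<theta>0 \<gamma>0 x0 v0 \<xi>0 xbar"
abbreviation a3 where "a3 \<equiv> alpha3 f L A b \<theta>0 \<gamma>0 x0 v0 \<xi>0 \<alpha>s xbar"
abbreviation avec where "avec \<equiv> alpha_vec f L A b \<theta>0 \<gamma>0 x0 v0 \<xi>0 \<alpha>s xbar"
abbreviation R where "R \<equiv> level_radius f a0"

lemma decay_objective:
  "z \<in> feasible A b \<Longrightarrow> t \<ge> 0 \<Longrightarrow> (MIN j. f j (x t) - f j z) \<le> K0 (norm z) 0 * exp (- t)"
  using decay[of z t 0] by (simp add: feasible_def)

text \<open>The decay estimate at \<open>xbar\<close> controls only the objective attaining the
  minimum, and that index may change with \<open>t\<close>. Every level set being bounded, the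
  maximum over indices in \<open>level_radius\<close> still bounds the norm.\<close>

lemma trajectory_bounded: assumes t: "t \<ge> 0" shows "norm (x t) \<le> R"
proof -
  obtain j where j: "(MIN j. f j (x t) - f j xbar) = f j (x t) - f j xbar" by (rule Min_range_obtain)
  have "f j (x t) - f j xbar \<le> K0 (norm xbar) 0 * exp (- t)"
    using decay_objective[OF xbar t] unfolding j .
  also have "\<dots> \<le> K0 (norm xbar) 0 * 1"
    using K0_nonneg[of "norm xbar" 0] t by (intro mult_left_mono) simp_all
  finally have "f j (x t) \<le> f j xbar + K0 (norm xbar) 0" by simp
  moreover have "f j xbar \<le> f j x0 + C1 f L x0 (norm xbar)" using objective_diff_le_C1[of j xbar x0] by simp
  moreover have "f j x0 \<le> (MAX j. \<bar>f j x0\<bar>)"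
    by (rule order_trans[OF abs_ge_self]) simp
  ultimately have "f j (x t) \<le> a0" unfolding alpha0_def by linarith
  then show ?thesis by (rule norm_le_level_radius[OF level_bounded])
qed

lemma R_nonneg: "0 \<le> R"
  using order_trans[OF norm_ge_zero trajectory_bounded[of 0]] by simp

text \<open>The norm bound now controls all objectives at once, not just the active one; this brings
  points below \<open>x t\<close> within reach of the Pareto radius.\<close>

lemma trajectory_in_level_set: assumes t: "t \<ge> 0" shows "x t \<in> vlevel_set f avec"
  unfolding mem_vlevel_set
proof
  fix j
  have "f j (x t) \<le> f j x0 + C1 f L x0 R"
    using objective_diff_le_C1[of j "x t" x0] C1_mono[OF norm_ge_zero trajectory_bounded[OF t], of x0]
    by simp
  then show "f j (x t) \<le> avec $ j" by (simp add: alpha_vec_def objective_def)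
qed

lemma sigma_pos: "sigma_min_pos A > 0"
  by (rule sigma_min_pos(1)[OF A_nonzero])

lemma a1_nonneg: "0 \<le> a1"
  unfolding alpha1_def using R_nonneg sigma_pos onorm_pos_le[OF matrix_vector_mul_bounded_linear[of A]]
  by simp

lemma a2_nonneg: "0 \<le> a2"
  unfolding alpha2_def using a1_nonneg L_nonneg G_nonneg sigma_pos by simp

lemma a3_ge: "K0 (pareto_radius f (feasible A b) avec) 0 \<le> a3" "a2 * K0 a1 (1 + a2) \<le> a3"
  unfolding alpha3_def Let_def by simp_all

lemma a3_nonneg: "0 \<le> a3"
  by (rule order_trans[OF _ a3_ge(2)]) (simp add: a1_nonneg a2_nonneg K0_nonneg)

lemma Min_diff_le:
  assumes z: "z \<in> feasible A b" and t: "t \<ge> 0"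
  shows "(MIN j. f j (x t) - f j z) \<le> a3 * exp (- t)"
\<comment> \<open>A negative minimum satisfies the bound trivially. Otherwise every objective at
  \<open>z\<close> lies below its value at \<open>x t\<close>, which puts \<open>z\<close> into the
  level set of \<open>avec\<close>.\<close>
proof (cases "(MIN j. f j (x t) - f j z) \<ge> 0")
  case False
  moreover have "0 \<le> a3 * exp (- t)" using a3_nonneg by simp
  ultimately show ?thesis by linarith
next
  case True
  have zx: "f j z \<le> f j (x t)" for j
    using order_trans[OF True Min_range_le[of "\<lambda>j. f j (x t) - f j z" j]] by simp
  have "z \<in> vlevel_set f avec"
    using trajectory_in_level_set[OF t] zx order_trans unfolding mem_vlevel_set by blast
  then obtain ys where ys: "ys \<in> weak_pareto f (feasible A b)" "ys \<in> vlevel_set f (objective f z)"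
    using pareto[of z avec] z by blast
  have ysz: "f j ys \<le> f j z" for j using ys(2) by (simp add: mem_vlevel_set objective_def)
  have "ys \<in> vlevel_set f avec"
    using \<open>z \<in> vlevel_set f avec\<close> ysz order_trans unfolding mem_vlevel_set by blast
  with ys(1) have "ys \<in> weak_pareto f (feasible A b) \<inter> vlevel_set f avec" by simp
  then obtain w where w: "w \<in> feasible A b" "objective f w = objective f ys"
    "norm w \<le> pareto_radius f (feasible A b) avec"
    by (rule pareto_radius_attained[OF level_bounded continuous_objective closed_feasible])
  have wz: "f j w \<le> f j z" for j
    using ysz[of j] w(2) by (simp add: objective_def vec_eq_iff)
  obtain j where j: "(MIN j. f j (x t) - f j w) = f j (x t) - f j w" by (rule Min_range_obtain)
  have "(MIN j. f j (x t) - f j z) \<le> f j (x t) - f j z" by (rule Min_range_le)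
  \<comment> \<open>Lowering all objectives from \<open>z\<close> to \<open>w\<close> can only raise
    the minimum, and \<open>w\<close> has a norm bounded independently of \<open>z\<close>.\<close>
  also have "\<dots> \<le> (MIN j. f j (x t) - f j w)" unfolding j using wz[of j] by simp
  also have "\<dots> \<le> K0 (norm w) 0 * exp (- t)" by (rule decay_objective[OF w(1) t])
  also have "\<dots> \<le> a3 * exp (- t)"
    by (intro mult_right_mono order_trans[OF K0_mono[OF _ w(3)] a3_ge(1)]) simp_all
  finally show ?thesis .
qed

lemma Min_diff_ge:
  assumes t: "t \<ge> 0"
  obtains z where "z \<in> feasible A b" "- (a3 * exp (- t)) \<le> (MIN j. f j (x t) - f j z)"
proof -
  define \<sigma> where "\<sigma> = sigma_min_pos A"
  define \<rho> where "\<rho> = norm (A *v x t - b)"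
  have \<sigma>: "\<sigma> > 0" using sigma_pos by (simp add: \<sigma>_def)
  obtain z where z: "z \<in> feasible A b" and dist: "norm (x t - z) \<le> \<rho> / \<sigma>"
    using feasible_error_bound[OF A_nonzero, of b "x t"] xbar unfolding \<rho>_def \<sigma>_def by blast
  have "\<rho> \<le> norm (A *v x t) + norm b" unfolding \<rho>_def by (rule norm_triangle_ineq4)
  also have "norm (A *v x t) \<le> opnorm A * norm (x t)" by (rule onorm) simp
  also have "\<dots> \<le> opnorm A * R"
    by (intro mult_left_mono trajectory_bounded t onorm_pos_le) simp
  finally have "\<rho> / \<sigma> \<le> (opnorm A * R + norm b) / \<sigma>" using \<sigma> by (simp add: divide_right_mono)
  moreover have "norm z \<le> norm (x t) + norm (x t - z)"
    using norm_triangle_ineq4[of "x t" "x t - z"] by simp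
  ultimately have "norm z \<le> R + (opnorm A * R + norm b) / \<sigma>"
    using dist trajectory_bounded[OF t] by linarith
  also have "\<dots> = a1" unfolding alpha1_def \<sigma>_def by (simp add: field_simps add_divide_distrib)
  finally have z_a1: "norm z \<le> a1" .
  define M where "M = (MIN j. f j (x t) - f j z)"
  have M_ge: "- (a2 * \<rho>) \<le> M"
  proof -
    \<comment> \<open>The gradient is taken at \<open>z\<close>, where its norm is at most
      \<open>G + L * a1\<close>; \<open>a2\<close> is this number divided by
      \<open>\<sigma>\<close>, so the error bound yields exactly \<open>a2 * \<rho>\<close>.\<close>
    obtain j where j: "M = f j (x t) - f j z" unfolding M_def by (rule Min_range_obtain)
    have "f j z - f j (x t) \<le> norm (grad (f j) z) * norm (z - x t)"
      by (rule order_trans[OF gradient_inequality norm_cauchy_schwarz])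
    also have "\<dots> \<le> (\<sigma> * a2) * (\<rho> / \<sigma>)"
    proof (rule mult_mono)
      have "G + L * norm z \<le> G + L * a1" using z_a1 L_nonneg by (simp add: mult_left_mono)
      also have "\<dots> = \<sigma> * a2" using \<sigma> unfolding alpha2_def \<sigma>_def[symmetric] by simp
      finally show "norm (grad (f j) z) \<le> \<sigma> * a2" using norm_grad_le order_trans by blast
      show "norm (z - x t) \<le> \<rho> / \<sigma>" using dist by (simp add: norm_minus_commute)
    qed (use \<sigma> a2_nonneg in simp_all)
    also have "\<dots> = a2 * \<rho>" using \<sigma> by simp
    finally show ?thesis unfolding j by simp
  qed
  \<comment> \<open>Of the weight \<open>1 + a2\<close>, the part \<open>a2\<close> offsets the
    possible loss \<open>- (a2 * \<rho>)\<close> in \<open>M\<close> and one copy of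
    \<open>\<rho>\<close> remains to be bounded. For a zero residual \<open>sgn\<close> gives
    \<open>\<eta> = 0\<close>, hence only an inequality for \<open>norm \<eta>\<close>
    below.\<close>
  define \<eta> where "\<eta> = (1 + a2) *\<^sub>R sgn (A *v x t - b)"
  have "\<eta> \<bullet> (A *v x t - b) = (1 + a2) * \<rho>"
    unfolding \<eta>_def \<rho>_def sgn_div_norm
    by (cases "A *v x t - b = 0") (simp_all add: power2_norm_eq_inner[symmetric] power2_eq_square)
  moreover have "norm \<eta> \<le> 1 + a2"
    unfolding \<eta>_def using a2_nonneg by (simp add: norm_sgn)
  then have "K0 (norm z) (norm \<eta>) * exp (- t) \<le> K0 a1 (1 + a2) * exp (- t)"
    using z_a1 by (intro mult_right_mono K0_mono) simp_all
  moreover have "M + \<eta> \<bullet> (A *v x t - b) \<le> K0 (norm z) (norm \<eta>) * exp (- t)"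
    unfolding M_def using z by (intro decay t) (simp add: feasible_def)
  ultimately have "M + (1 + a2) * \<rho> \<le> K0 a1 (1 + a2) * exp (- t)" by linarith
  then have "\<rho> \<le> K0 a1 (1 + a2) * exp (- t)"
    using M_ge by (simp add: distrib_right)
  then have "a2 * \<rho> \<le> a2 * (K0 a1 (1 + a2) * exp (- t))" using a2_nonneg by (rule mult_left_mono)
  also have "\<dots> \<le> a3 * exp (- t)"
    using mult_right_mono[OF a3_ge(2), of "exp (- t)"] by (simp add: mult.assoc)
  finally have "- (a3 * exp (- t)) \<le> M" using M_ge by linarith
  with z show thesis unfolding M_def by (rule that)
qed

lemma abs_gap_le:
  assumes t: "t \<ge> 0"
  shows "\<bar>gap f (feasible A b) (x t)\<bar> \<le> a3 * exp (- t)"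
proof -
  obtain z where z: "z \<in> feasible A b" "- (a3 * exp (- t)) \<le> (MIN j. f j (x t) - f j z)"
    using Min_diff_ge[OF t] .
  have "gap f (feasible A b) (x t) \<le> a3 * exp (- t)"
    unfolding gap_def by (rule cSUP_least) (use xbar Min_diff_le[OF _ t] in auto)
  \<comment> \<open>The upper estimate also supplies the boundedness above that lets the real
    supremum dominate its members.\<close>
  moreover have "(MIN j. f j (x t) - f j z) \<le> gap f (feasible A b) (x t)"
    unfolding gap_def by (rule cSUP_upper[OF z(1)]) (rule bdd_aboveI2[OF Min_diff_le[OF _ t]])
  ultimately show ?thesis using z(2) by linarith
qed

end

theorem theorem4p2:
  fixes A :: "real^'n^'r" and b :: "real^'r"
    and f :: "'m::finite \<Rightarrow> real^'n \<Rightarrow> real"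
    and \<mu>f Lf :: "'m \<Rightarrow> real" and \<mu> L :: real
    and \<alpha>s :: "real^'m"
    and \<theta>0 \<gamma>0 :: real and \<theta> \<gamma> :: "real \<Rightarrow> real"
    and x0 v0 xbar :: "real^'n" and \<xi>0 :: "real^'r"
    and x v :: "real \<Rightarrow> real^'n" and \<xi> :: "real \<Rightarrow> real^'r"
  assumes A_nonzero: "A \<noteq> 0"
    and feasible_nonempty: "feasible A b \<noteq> {}"
    and f_differentiable: "\<And>j. f j differentiable_on UNIV"
    and f_C1: "\<And>j. continuous_on UNIV (grad (f j))"
    and f_smooth: "\<And>j. (Lf j)-lipschitz_on UNIV (grad (f j))"
    and f_convex: "\<And>j x y. f j y - f j x - grad (f j) x \<bullet> (y - x) \<ge> \<mu>f j / 2 * (norm (x - y))\<^sup>2"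
    and moduli: "\<And>j. 0 \<le> \<mu>f j" "\<And>j. \<mu>f j \<le> Lf j"
    and mu_def: "\<mu> = (MIN j. \<mu>f j)"
    and L_def: "L = (MAX j. Lf j)"
    and level_bounded: "\<And>j a. bounded (level_set (f j) a)"
    and alpha_star: "vlevel_set f \<alpha>s \<inter> feasible A b \<noteq> {}"
    and pareto: "\<And>a y. y \<in> vlevel_set f a \<inter> feasible A b \<Longrightarrow>
      \<exists>ys. ys \<in> weak_pareto f (feasible A b) \<inter> vlevel_set f (objective f y)"
    and theta_pos: "\<theta>0 > 0" and gamma_pos: "\<gamma>0 > 0"
    and theta_ode: "\<And>t. t \<ge> 0 \<Longrightarrow> (\<theta> has_real_derivative - \<theta> t) (at t within {0..})"
    and theta_init: "\<theta> 0 = \<theta>0"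
    and gamma_ode: "\<And>t. t \<ge> 0 \<Longrightarrow> (\<gamma> has_real_derivative \<mu> - \<gamma> t) (at t within {0..})"
    and gamma_init: "\<gamma> 0 = \<gamma>0"
    and solution: "ampd_di_solution f \<mu> A b \<theta> \<gamma> x0 v0 \<xi>0 x v \<xi>"
    and xbar: "xbar \<in> feasible A b"
  shows "\<forall>t>0. \<bar>gap f (feasible A b) (x t)\<bar> \<le> alpha3 f L A b \<theta>0 \<gamma>0 x0 v0 \<xi>0 \<alpha>s xbar * exp (- t)"
proof -
  interpret ampd_pareto f \<mu>f Lf \<mu> L A b \<theta>0 \<gamma>0 \<theta> \<gamma> x0 v0 \<xi>0 x v \<xi> \<alpha>s xbar
    by unfold_locales (fact assms)+
  show ?thesis using abs_gap_le by simp
qed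

end
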